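(* For every real $\varepsilon > 0$, every integer $k \geq 2$ and every linear $k$-hypertree $T$, there exist positive real numbers $C = C(\varepsilon, T)$ and $n_0 = n_0(\varepsilon, T)$ such that the following holds for all $n \geq n_0$. If $H$ is an $n$-vertex linear $k$-graph with $\delta(H) \geq \frac{n}{k} + C$, then $H$ contains a collection of vertex-disjoint copies of $T$ that covers at least $(1 - \varepsilon)n$ vertices of $H$.
   Context: A $k$-graph is a (simple, finite) hypergraph in which every edge has exactly $k$ vertices. A hypergraph is linear if every two distinct edges share at most one vertex. The degree of a vertex is the number of edges containing it, and $\delta(H)$ denotes the minimum degree of $H$. A copy of $T$ in $H$ is a (not necessarily induced) sub-hypergraph of $H$ isomorphic to $T$. Linear paths. For $\ell\ge 2$, a linear ($k$-)path of length $\ell$ is a $k$-graph with vertex set $\{x_1,\dots,x_{\ell+1}\}\cup\{y_{i,j}: 1\le i\le \ell,\ 1\le j\le k-2\}$ (all these vertices distinct) and edges $\{x_i,y_{i,1},\dots,y_{i,k-2},x_{i+1}\}$ for $1\le i\le \ell$. Its two ends are the sets $\{x_1,y_{1,1},\dots,y_{1,k-2}\}$ and $\{x_{\ell+1},y_{\ell,1},\dots,y_{\ell,k-2}\}$. A linear path of length one is a $k$-graph with $k$ vertices and one edge. A linear $u$--$v$ path is a linear path together with two distinct vertices $u,v$ such that, if the length is at least $2$, $u$ lies in one end and $v$ lies in the other end, and, if the length is one, $u,v$ are any two vertices of the edge. A linear $k$-hypertree is a $k$-graph $T$ such that for every pair $\{u,v\}$ of distinct vertices of $T$ there is a unique linear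 $u$--$v$ path in $T$ (as a sub-hypergraph). *)

theory Defs
  imports Complex_Main
begin

datatype 'a hypergraph = Hypergraph (verts: "'a set") (edges: "'a set set")

definition hypergraph :: "'a hypergraph \<Rightarrow> bool" where
  "hypergraph H \<longleftrightarrow> finite (verts H) \<and> (\<forall>e\<in>edges H. e \<subseteq> verts H)"

definition k_graph :: "nat \<Rightarrow> 'a hypergraph \<Rightarrow> bool" where
  "k_graph k H \<longleftrightarrow> hypergraph H \<and> (\<forall>e\<in>edges H. card e = k)"

definition linear_hypergraph :: "'a hypergraph \<Rightarrow> bool" where
  "linear_hypergraph H \<longleftrightarrow>
     (\<forall>e\<in>edges H. \<forall>f\<in>edges H. e \<noteq> f \<longrightarrow> card (e \<inter> f) \<le> 1)"

definition vertex_degree :: "'a hypergraph \<Rightarrow> 'a \<Rightarrow> nat" where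
  "vertex_degree H v = card {e \<in> edges H. v \<in> e}"

text \<open>Only meaningful when the vertex set is finite and nonempty.\<close>

definition min_degree :: "'a hypergraph \<Rightarrow> nat" where
  "min_degree H = Min (vertex_degree H ` verts H)"

definition sub_hypergraph :: "'a hypergraph \<Rightarrow> 'a hypergraph \<Rightarrow> bool" where
  "sub_hypergraph G H \<longleftrightarrow> hypergraph G \<and> verts G \<subseteq> verts H \<and> edges G \<subseteq> edges H"

definition isomorphic :: "'a hypergraph \<Rightarrow> 'b hypergraph \<Rightarrow> bool" where
  "isomorphic G H \<longleftrightarrow>
     (\<exists>f. bij_betw f (verts G) (verts H) \<and> edges H = (\<lambda>e. f ` e) ` edges G)"

definition is_copy :: "'a hypergraph \<Rightarrow> 'b hypergraph \<Rightarrow> 'b hypergraph \<Rightarrow> bool" where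
  "is_copy T H G \<longleftrightarrow> sub_hypergraph G H \<and> isomorphic T G"

definition path_edge :: "nat \<Rightarrow> (nat \<Rightarrow> 'a) \<Rightarrow> (nat \<Rightarrow> nat \<Rightarrow> 'a) \<Rightarrow> nat \<Rightarrow> 'a set" where
  "path_edge k x y i = {x i, x (i + 1)} \<union> y i ` {1..k - 2}"

definition first_end :: "nat \<Rightarrow> (nat \<Rightarrow> 'a) \<Rightarrow> (nat \<Rightarrow> nat \<Rightarrow> 'a) \<Rightarrow> 'a set" where
  "first_end k x y = {x 1} \<union> y 1 ` {1..k - 2}"

definition last_end :: "nat \<Rightarrow> nat \<Rightarrow> (nat \<Rightarrow> 'a) \<Rightarrow> (nat \<Rightarrow> nat \<Rightarrow> 'a) \<Rightarrow> 'a set" where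
  "last_end k l x y = {x (l + 1)} \<union> y l ` {1..k - 2}"

text \<open>\<open>P\<close> is a linear path of length \<open>l \<ge> 2\<close> with the vertex labelling \<open>x\<close>, \<open>y\<close>;
  the first three conjuncts after the bound say that all labelled vertices are distinct.\<close>

definition labelled_linear_path ::
  "nat \<Rightarrow> nat \<Rightarrow> (nat \<Rightarrow> 'a) \<Rightarrow> (nat \<Rightarrow> nat \<Rightarrow> 'a) \<Rightarrow> 'a hypergraph \<Rightarrow> bool" where
  "labelled_linear_path k l x y P \<longleftrightarrow>
     l \<ge> 2 \<and>
     inj_on x {1..l + 1} \<and>
     inj_on (\<lambda>(i, j). y i j) ({1..l} \<times> {1..k - 2}) \<and>
     x ` {1..l + 1} \<inter> (\<lambda>(i, j). y i j) ` ({1..l} \<times> {1..k - 2}) = {} \<and>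
     verts P = x ` {1..l + 1} \<union> (\<lambda>(i, j). y i j) ` ({1..l} \<times> {1..k - 2}) \<and>
     edges P = path_edge k x y ` {1..l}"

definition linear_path_length_one :: "nat \<Rightarrow> 'a hypergraph \<Rightarrow> bool" where
  "linear_path_length_one k P \<longleftrightarrow>
     k_graph k P \<and> card (verts P) = k \<and> card (edges P) = 1"

definition linear_uv_path :: "nat \<Rightarrow> 'a \<Rightarrow> 'a \<Rightarrow> 'a hypergraph \<Rightarrow> bool" where
  "linear_uv_path k u v P \<longleftrightarrow> u \<noteq> v \<and>
     (linear_path_length_one k P \<and> u \<in> verts P \<and> v \<in> verts P \<or>
      (\<exists>l x y. labelled_linear_path k l x y P \<and>
         (u \<in> first_end k x y \<and> v \<in> last_end k l x y \<or>
          v \<in> first_end k x y \<and> u \<in> last_end k l x y)))"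

text \<open>The vertex set of a hypertree is required to be nonempty, as usual for trees; a single
  vertex without edges is a hypertree.\<close>

definition linear_hypertree :: "nat \<Rightarrow> 'a hypergraph \<Rightarrow> bool" where
  "linear_hypertree k T \<longleftrightarrow> k_graph k T \<and> verts T \<noteq> {} \<and>
     (\<forall>u\<in>verts T. \<forall>v\<in>verts T. u \<noteq> v \<longrightarrow>
        (\<exists>!P. sub_hypergraph P T \<and> linear_uv_path k u v P))"

definition vertex_disjoint :: "'a hypergraph set \<Rightarrow> bool" where
  "vertex_disjoint \<C> \<longleftrightarrow> pairwise (\<lambda>G G'. disjnt (verts G) (verts G')) \<C>"

end

theory Submission
  imports Defs "HOL-Analysis.Convex" "HOL-Library.Disjoint_Sets"
begin

text \<open>
  Let \<open>H\<close> have \<open>n\<close> vertices. Among all sets of edges of \<open>H\<close>, take one minimising the sum of the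
  squares \<open>(D - deg v)\<^sup>2\<close>, where \<open>D\<close> is a small constant times \<open>n\<close>. Local minimality together with
  \<open>\<delta>(H) \<ge> n/k\<close> and linearity forces almost all degrees to be close to \<open>D\<close>. In the resulting almost
  regular linear hypergraph the embeddings of the tree \<open>T\<close>, counted edge by edge, cover almost all
  vertices almost equally often, and pairs of vertices negligibly often. So the copies of \<open>T\<close> form
  an almost regular uniform family with small codegrees, which has an almost perfect matching.

  That matching is built greedily instead of by a random nibble: for a random edge, chosen with
  probability proportional to its weight, the expected increase of the sum of the squares of
  (degree minus expected degree) over the remaining vertices is small, so at each step some edge
  achieves this, and the potential stays small until almost everything is covered.
\<close>

section \<open>Almost perfect matchings\<close>

text \<open>The hypothesis \<open>\<delta>(H) \<ge> n/k\<close> acts at a vertex \<open>v\<close>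
  whose shortfall \<open>a\<close> below \<open>D\<close> is largest, up to few exceptions.
  Minimality says that inserting an omitted edge does not help, so the shortfalls on it sum to at
  most \<open>k/2\<close>. By linearity the edges at \<open>v\<close> are otherwise disjoint, and at
  least \<open>n/k\<close> of them are enough to offset a shortfall \<open>a\<close> at all
  \<open>n\<close> vertices, so the total shortfall is small. Edges already chosen at
  \<open>v\<close> spoil this estimate; \<open>D\<close> is a small fraction of \<open>n\<close> so
  that they matter at few vertices only. On the other hand \<open>D\<close> is linear in
  \<open>n\<close>, since prescribing a second vertex of an embedded tree divides the number of
  embeddings by about \<open>D\<close>, and this makes the codegrees tend to zero.

  The danger in the greedy matching is that deviations feed on themselves over linearly many steps.
  The leading part of the expected change turns out to be nonpositive by Cauchy-Schwarz, which
  leaves a growth factor \<open>1 + O(1/n)\<close> per step and a bounded factor in total. A small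
  enough initial potential compensates for it.\<close>

lemma weighted_average_le:
  fixes w A :: "'i \<Rightarrow> real"
  assumes "finite I" "\<And>e. e \<in> I \<Longrightarrow> 0 \<le> w e" "0 < (\<Sum>e\<in>I. w e)"
    and "(\<Sum>e\<in>I. w e * A e) \<le> (\<Sum>e\<in>I. w e) * R"
  shows "\<exists>e\<in>I. A e \<le> R"
proof (rule ccontr)
  assume "\<not> ?thesis"
  then have gt: "A e > R" if "e \<in> I" for e
    using that by force
  have nonneg: "0 \<le> w e * (A e - R)" if "e \<in> I" for e
    using gt[OF that] assms(2)[OF that] by simp
  have "(\<Sum>e\<in>I. w e * (A e - R)) \<le> 0"
    using assms(4) by (simp add: algebra_simps sum_subtractf sum_distrib_left)
  then have "(\<Sum>e\<in>I. w e * (A e - R)) = 0"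
    using sum_nonneg[of I "\<lambda>e. w e * (A e - R)"] nonneg by force
  then have "\<forall>e\<in>I. w e * (A e - R) = 0"
    using sum_nonneg_eq_0_iff[of I "\<lambda>e. w e * (A e - R)"] nonneg assms(1) by blast
  then have "\<forall>e\<in>I. w e = 0"
    using gt by force
  then show False
    using assms(3) by simp
qed

text \<open>Serves to bound a product of many decay factors of the expected degree below by a
  constant.\<close>

lemma exp_le_one_minus:
  fixes x :: real
  assumes "0 \<le> x" "x \<le> 1 / 2"
  shows "exp (- 2 * x) \<le> 1 - x"
proof -
  have "x * x \<le> x * (1 / 2)" using assms by (intro mult_left_mono) auto
  then have "- 2 * x \<le> - x - 2 * x\<^sup>2" by (simp add: power2_eq_square)
  also have "\<dots> \<le> ln (1 - x)" using assms by (intro ln_one_minus_pos_lower_bound) auto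
  finally have "exp (- 2 * x) \<le> exp (ln (1 - x))" by simp
  then show ?thesis using assms by simp
qed

lemma weighted_card_inter:
  fixes w :: "'i \<Rightarrow> real"
  assumes "finite I" "finite B"
  shows "(\<Sum>u\<in>B. \<Sum>i\<in>{i\<in>I. u \<in> S i}. w i) = (\<Sum>i\<in>I. w i * real (card (B \<inter> S i)))"
proof -
  have "(\<Sum>u\<in>B. \<Sum>i\<in>{i\<in>I. u \<in> S i}. w i) = (\<Sum>i\<in>I. \<Sum>u\<in>{u\<in>B. u \<in> S i}. w i)"
    by (rule sum.swap_restrict[OF assms(2,1)])
  also have "\<dots> = (\<Sum>i\<in>I. w i * real (card (B \<inter> S i)))"
    by (intro sum.cong refl) (simp add: Int_def mult.commute)
  finally show ?thesis .
qed

text \<open>Adding up the degrees on \<open>B - {v}\<close> counts every set that avoids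
  \<open>v\<close> and meets \<open>B\<close> at least once. All surplus comes from sets with two
  points in \<open>B\<close>, so it can be charged to the at most \<open>t^2\<close> ordered pairs
  of distinct points of \<open>B\<close>.\<close>

lemma inter_weight_bounds:
  fixes w :: "'i \<Rightarrow> real" and I :: "'i set" and S :: "'i \<Rightarrow> 'b set"
  defines "d \<equiv> \<lambda>v. \<Sum>i\<in>{i\<in>I. v \<in> S i}. w i"
  assumes fin: "finite I" and finB: "finite B" and card: "card B = t" and v: "v \<in> B"
    and w: "\<And>i. i \<in> I \<Longrightarrow> 0 \<le> w i" and \<gamma>: "0 \<le> \<gamma>"
    and codeg: "\<And>u u'. u \<in> B \<Longrightarrow> u' \<in> B \<Longrightarrow> u \<noteq> u' \<Longrightarrow>
          (\<Sum>i\<in>{i\<in>I. u \<in> S i \<and> u' \<in> S i}. w i) \<le> \<gamma>"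
  defines "a \<equiv> (\<Sum>i\<in>{i\<in>I. v \<notin> S i \<and> S i \<inter> B \<noteq> {}}. w i)"
  shows "a \<le> (\<Sum>u\<in>B - {v}. d u)" and "(\<Sum>u\<in>B - {v}. d u) \<le> a + real t ^ 2 * \<gamma>"
proof -
  have a_eq: "a = (\<Sum>i\<in>I. w i * of_bool (v \<notin> S i \<and> S i \<inter> B \<noteq> {}))"
    unfolding a_def using fin by (simp add: sum.inter_filter of_bool_def if_distrib cong: if_cong)
  have d_eq: "(\<Sum>u\<in>B - {v}. d u) = (\<Sum>i\<in>I. w i * real (card ((B - {v}) \<inter> S i)))"
    unfolding d_def using weighted_card_inter[OF fin, of "B - {v}" w S] finB by simp
  show "a \<le> (\<Sum>u\<in>B - {v}. d u)"
    unfolding a_eq d_eq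
  proof (intro sum_mono mult_left_mono w)
    fix i
    show "of_bool (v \<notin> S i \<and> S i \<inter> B \<noteq> {}) \<le> real (card ((B - {v}) \<inter> S i))"
    proof (cases "v \<notin> S i \<and> S i \<inter> B \<noteq> {}")
      case True
      then have "(B - {v}) \<inter> S i \<noteq> {}" by auto
      then have "card ((B - {v}) \<inter> S i) > 0" using finB by (simp add: card_gt_0_iff)
      then show ?thesis using True by simp
    next
      case False
      then show ?thesis by (auto simp: of_bool_def)
    qed
  qed
  define P where "P = {p \<in> B \<times> B. fst p \<noteq> snd p}"
  have finP: "finite P" unfolding P_def using finB by simp
  have cardP: "card P \<le> t ^ 2"
    using card_mono[of "B \<times> B" P] finB card by (auto simp: P_def card_cartesian_product power2_eq_square)
  \<comment> \<open>With \<open>j = card J\<close>, this is \<open>j - 1 \<le> j * (j - 1)\<close>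
    if \<open>v \<in> S i\<close>, and otherwise \<open>j \<le> 1 + j * (j - 1)\<close> for
    \<open>j \<ge> 1\<close>.\<close>
  have pt: "real (card ((B - {v}) \<inter> S i))
      \<le> of_bool (v \<notin> S i \<and> S i \<inter> B \<noteq> {}) + real (card {p\<in>P. fst p \<in> S i \<and> snd p \<in> S i})" for i
  proof -
    define J where "J = B \<inter> S i"
    have finJ: "finite J" using finB by (simp add: J_def)
    have eq: "{p\<in>P. fst p \<in> S i \<and> snd p \<in> S i} = J \<times> J - (\<lambda>x. (x, x)) ` J"
      by (auto simp: P_def J_def)
    have "card {p\<in>P. fst p \<in> S i \<and> snd p \<in> S i} = card J * card J - card J"
      unfolding eq using finJ
      by (subst card_Diff_subset) (auto simp: card_cartesian_product card_image inj_on_def)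
    then have pc: "card {p\<in>P. fst p \<in> S i \<and> snd p \<in> S i} = card J * (card J - 1)"
      by (simp add: diff_mult_distrib2)
    show ?thesis
    proof (cases "v \<in> S i")
      case True
      then have "(B - {v}) \<inter> S i = J - {v}" "v \<in> J" using v by (auto simp: J_def)
      then have "card ((B - {v}) \<inter> S i) = card J - 1" "card J > 0"
        using finJ by (auto simp: card_gt_0_iff)
      then have "card ((B - {v}) \<inter> S i) \<le> card J * (card J - 1)" by simp
      then show ?thesis using pc True by (simp del: of_nat_mult)
    next
      case False
      then have eqJ: "(B - {v}) \<inter> S i = J" by (auto simp: J_def)
      show ?thesis
      proof (cases "J = {}")
        case True then show ?thesis using eqJ by simp
      next
        case ne: False
        then have "card J > 0" using finJ by (simp add: card_gt_0_iff)
        then obtain j where j: "card J = Suc j" by (cases "card J") auto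
        have "card J \<le> 1 + card J * (card J - 1)" unfolding j by simp
        moreover have "v \<notin> S i \<and> S i \<inter> B \<noteq> {}" using False ne by (auto simp: J_def)
        ultimately show ?thesis using eqJ pc by (simp del: of_nat_mult)
      qed
    qed
  qed
  have "(\<Sum>u\<in>B - {v}. d u) \<le> (\<Sum>i\<in>I. w i * (of_bool (v \<notin> S i \<and> S i \<inter> B \<noteq> {})
          + real (card {p\<in>P. fst p \<in> S i \<and> snd p \<in> S i})))"
    unfolding d_eq by (intro sum_mono mult_left_mono pt w)
  also have "\<dots> = a + (\<Sum>i\<in>I. \<Sum>p\<in>{p\<in>P. fst p \<in> S i \<and> snd p \<in> S i}. w i)"
    unfolding a_eq by (simp add: distrib_left sum.distrib mult.commute)
  also have "(\<Sum>i\<in>I. \<Sum>p\<in>{p\<in>P. fst p \<in> S i \<and> snd p \<in> S i}. w i)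
      = (\<Sum>p\<in>P. \<Sum>i\<in>{i\<in>I. fst p \<in> S i \<and> snd p \<in> S i}. w i)"
    by (rule sum.swap_restrict[OF fin finP])
  also have "\<dots> \<le> (\<Sum>p\<in>P. \<gamma>)"
    by (intro sum_mono codeg) (auto simp: P_def)
  also have "\<dots> \<le> real t ^ 2 * \<gamma>"
    using cardP \<gamma> by (simp add: mult_right_mono flip: of_nat_power)
  finally show "(\<Sum>u\<in>B - {v}. d u) \<le> a + real t ^ 2 * \<gamma>" by simp
qed


section \<open>Weighted set families and a single greedy step\<close>

definition wdeg :: "'i set \<Rightarrow> ('i \<Rightarrow> 'b set) \<Rightarrow> ('i \<Rightarrow> real) \<Rightarrow> 'b \<Rightarrow> real" where
  "wdeg I S w v = (\<Sum>i\<in>{i\<in>I. v \<in> S i}. w i)"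

definition wcodeg :: "'i set \<Rightarrow> ('i \<Rightarrow> 'b set) \<Rightarrow> ('i \<Rightarrow> real) \<Rightarrow> 'b \<Rightarrow> 'b \<Rightarrow> real" where
  "wcodeg I S w u v = (\<Sum>i\<in>{i\<in>I. u \<in> S i \<and> v \<in> S i}. w i)"

lemma sum_wdeg:
  assumes "finite V" "finite I" "\<And>i. i \<in> I \<Longrightarrow> S i \<subseteq> V"
  shows "(\<Sum>v\<in>V. f v * wdeg I S w v) = (\<Sum>i\<in>I. w i * (\<Sum>v\<in>S i. f v))"
proof -
  have "(\<Sum>v\<in>V. f v * wdeg I S w v) = (\<Sum>v\<in>V. \<Sum>i\<in>{i\<in>I. v \<in> S i}. f v * w i)"
    by (simp add: wdeg_def sum_distrib_left)
  also have "\<dots> = (\<Sum>i\<in>I. \<Sum>v\<in>{v\<in>V. v \<in> S i}. f v * w i)"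
    by (rule sum.swap_restrict[OF assms(1,2)])
  also have "\<dots> = (\<Sum>i\<in>I. w i * (\<Sum>v\<in>S i. f v))"
  proof (intro sum.cong refl)
    fix i assume "i \<in> I"
    then have "{v\<in>V. v \<in> S i} = S i" using assms(3) by blast
    then show "(\<Sum>v\<in>{v\<in>V. v \<in> S i}. f v * w i) = w i * (\<Sum>v\<in>S i. f v)"
      by (simp add: sum_distrib_left mult.commute)
  qed
  finally show ?thesis .
qed

text \<open>Sets are indexed because several embeddings of a tree can have the same image and must
  be counted separately. Degrees are normalised to be at most 1, so that \<open>\<gamma>\<close>
  measures codegrees relative to degrees.\<close>

locale weighted_family =
  fixes V :: "'b set" and I :: "'i set" and S :: "'i \<Rightarrow> 'b set" and w :: "'i \<Rightarrow> real"
    and t :: nat and \<gamma> :: real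
  assumes finV: "finite V" and finI: "finite I"
    and SV: "\<And>i. i \<in> I \<Longrightarrow> S i \<subseteq> V" and cardS: "\<And>i. i \<in> I \<Longrightarrow> card (S i) = t"
    and w: "\<And>i. i \<in> I \<Longrightarrow> 0 \<le> w i" and t: "t \<ge> 1" and \<gamma>: "\<gamma> \<ge> 0"
    and deg: "\<And>v. v \<in> V \<Longrightarrow> wdeg I S w v \<le> 1"
    and codeg: "\<And>u v. u \<in> V \<Longrightarrow> v \<in> V \<Longrightarrow> u \<noteq> v \<Longrightarrow> wcodeg I S w u v \<le> \<gamma>"
begin

text \<open>The drop in the degree of \<open>v\<close> when \<open>S e\<close> joins the matching
  and all sets meeting it are discarded; see \<open>wdeg_remove\<close>.\<close>

definition loss :: "'i \<Rightarrow> 'b \<Rightarrow> real" where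
  "loss e v = (\<Sum>i\<in>{i\<in>I. v \<in> S i \<and> S i \<inter> S e \<noteq> {}}. w i)"

lemma loss_nonneg: "0 \<le> loss e v"
  unfolding loss_def by (intro sum_nonneg w) auto

lemma finS: "i \<in> I \<Longrightarrow> finite (S i)"
  using SV finV finite_subset by blast

lemma wdeg_nonneg: "0 \<le> wdeg I S w v"
  unfolding wdeg_def by (intro sum_nonneg w) auto

lemma wcodeg_nonneg: "0 \<le> wcodeg I S w u v"
  unfolding wcodeg_def by (intro sum_nonneg w) auto

lemma loss_le_wcodeg:
  assumes "e \<in> I"
  shows "loss e v \<le> (\<Sum>u\<in>S e. wcodeg I S w u v)"
proof -
  have "loss e v \<le> (\<Sum>i\<in>{i\<in>I. v \<in> S i}. \<Sum>u\<in>{u\<in>S e. u \<in> S i}. w i)"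
  proof -
    have "loss e v = (\<Sum>i\<in>{i\<in>{i\<in>I. v \<in> S i}. S i \<inter> S e \<noteq> {}}. w i)"
      unfolding loss_def by (intro arg_cong2[where f=sum]) auto
    also have "\<dots> = (\<Sum>i\<in>{i\<in>I. v \<in> S i}. if S i \<inter> S e \<noteq> {} then w i else 0)"
      using finI by (intro sum.inter_filter) auto
    also have "\<dots> \<le> (\<Sum>i\<in>{i\<in>I. v \<in> S i}. \<Sum>u\<in>{u\<in>S e. u \<in> S i}. w i)"
    proof (intro sum_mono)
      fix i assume i: "i \<in> {i\<in>I. v \<in> S i}"
      show "(if S i \<inter> S e \<noteq> {} then w i else 0) \<le> (\<Sum>u\<in>{u\<in>S e. u \<in> S i}. w i)"
      proof (cases "S i \<inter> S e = {}")
        case True then show ?thesis using i w by (auto intro!: sum_nonneg)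
      next
        case False
        then have "card {u\<in>S e. u \<in> S i} > 0"
          using finS[OF assms] by (auto simp: card_gt_0_iff)
        then have "1 * w i \<le> real (card {u\<in>S e. u \<in> S i}) * w i"
          using i w by (intro mult_right_mono) auto
        then show ?thesis using False by simp
      qed
    qed
    finally show ?thesis .
  qed
  also have "\<dots> = (\<Sum>u\<in>S e. \<Sum>i\<in>{i\<in>{i\<in>I. v \<in> S i}. u \<in> S i}. w i)"
    using finI finS[OF assms] by (intro sum.swap_restrict) auto
  also have "\<dots> = (\<Sum>u\<in>S e. wcodeg I S w u v)"
    unfolding wcodeg_def by (intro sum.cong refl arg_cong2[where f=sum]) auto
  finally show ?thesis .
qed

text \<open>Supremum times sum: outside \<open>S e\<close> each loss is at most
  \<open>t * \<gamma>\<close>, and the codegree sums bounding the losses add up to at most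
  \<open>t^2\<close>, because each point of \<open>S e\<close> has degree at most 1 and each set has
  \<open>t\<close> points.\<close>

lemma sum_loss_square:
  assumes e: "e \<in> I"
  shows "(\<Sum>v\<in>V - S e. (loss e v)\<^sup>2) \<le> real t ^ 3 * \<gamma>"
proof -
  have le: "loss e v \<le> real t * \<gamma>" if "v \<in> V - S e" for v
  proof -
    have "loss e v \<le> (\<Sum>u\<in>S e. wcodeg I S w u v)" by (rule loss_le_wcodeg[OF e])
    also have "\<dots> \<le> (\<Sum>u\<in>S e. \<gamma>)" using that SV[OF e] by (intro sum_mono codeg) auto
    finally show ?thesis using cardS[OF e] by simp
  qed
  have "(\<Sum>v\<in>V - S e. (loss e v)\<^sup>2) \<le> (\<Sum>v\<in>V - S e. real t * \<gamma> * (\<Sum>u\<in>S e. wcodeg I S w u v))"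
    unfolding power2_eq_square
    using t \<gamma> by (intro sum_mono mult_mono le loss_le_wcodeg e loss_nonneg) auto
  also have "\<dots> \<le> real t * \<gamma> * (\<Sum>v\<in>V. \<Sum>u\<in>S e. wcodeg I S w u v)"
    unfolding sum_distrib_left[symmetric]
    using \<gamma> finV by (intro mult_left_mono sum_mono2 sum_nonneg wcodeg_nonneg) auto
  also have "(\<Sum>v\<in>V. \<Sum>u\<in>S e. wcodeg I S w u v) = (\<Sum>u\<in>S e. \<Sum>v\<in>V. wcodeg I S w u v)"
    by (rule sum.swap)
  also have "\<dots> = (\<Sum>u\<in>S e. real t * wdeg I S w u)"
  proof (intro sum.cong refl)
    fix u
    have "(\<Sum>v\<in>V. wcodeg I S w u v) = (\<Sum>v\<in>V. \<Sum>i\<in>{i\<in>{i\<in>I. u \<in> S i}. v \<in> S i}. w i)"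
      unfolding wcodeg_def by (intro sum.cong refl arg_cong2[where f=sum]) auto
    also have "\<dots> = (\<Sum>i\<in>{i\<in>I. u \<in> S i}. w i * real (card (V \<inter> S i)))"
      using finI finV by (intro weighted_card_inter) auto
    also have "\<dots> = (\<Sum>i\<in>{i\<in>I. u \<in> S i}. w i * real t)"
      using SV cardS by (intro sum.cong refl) (auto simp: Int_absorb1)
    finally show "(\<Sum>v\<in>V. wcodeg I S w u v) = real t * wdeg I S w u"
      by (simp add: wdeg_def sum_distrib_left mult.commute)
  qed
  also have "\<dots> \<le> (\<Sum>u\<in>S e. real t * 1)"
    using SV[OF e] deg by (intro sum_mono mult_left_mono) auto
  also have "\<dots> = real t * real t" using cardS[OF e] by simp
  finally have "(\<Sum>v\<in>V - S e. (loss e v)\<^sup>2) \<le> real t * \<gamma> * (real t * real t)"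
    using \<gamma> by (simp add: mult_left_mono)
  then show ?thesis by (simp add: power3_eq_cube algebra_simps)
qed

lemma total_weight: "(\<Sum>v\<in>V. wdeg I S w v) = real t * (\<Sum>i\<in>I. w i)"
  using sum_wdeg[OF finV finI SV, where f = "\<lambda>_. 1" and w = w] cardS
  by (simp add: sum_distrib_left mult.commute)

text \<open>Exchange \<open>e\<close> with the set \<open>f\<close> through \<open>v\<close> that it
  destroys. For fixed \<open>f\<close> the sets \<open>e\<close> in question avoid \<open>v\<close>
  and meet \<open>S f\<close>, and \<open>inter_weight_bounds\<close> compares their weight with the
  degrees on \<open>S f\<close>.\<close>

lemma averaged_loss:
  assumes v: "v \<in> V"
  defines "Q \<equiv> \<Sum>e\<in>{e\<in>I. v \<notin> S e}. w e * loss e v"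
    and "q \<equiv> \<Sum>f\<in>{f\<in>I. v \<in> S f}. w f * (\<Sum>u\<in>S f - {v}. wdeg I S w u)"
  shows "Q \<le> q" and "q \<le> Q + real t ^ 2 * \<gamma>"
proof -
  have "Q = (\<Sum>e\<in>{e\<in>I. v \<notin> S e}. \<Sum>f\<in>{f\<in>{f\<in>I. v \<in> S f}. S f \<inter> S e \<noteq> {}}. w e * w f)"
    unfolding Q_def loss_def sum_distrib_left
    by (intro sum.cong refl arg_cong2[where f=sum]) auto
  also have "\<dots> = (\<Sum>f\<in>{f\<in>I. v \<in> S f}. \<Sum>e\<in>{e\<in>{e\<in>I. v \<notin> S e}. S f \<inter> S e \<noteq> {}}. w e * w f)"
    using finI by (intro sum.swap_restrict) auto
  also have "\<dots> = (\<Sum>f\<in>{f\<in>I. v \<in> S f}. w f * (\<Sum>e\<in>{e\<in>I. v \<notin> S e \<and> S e \<inter> S f \<noteq> {}}. w e))"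
    unfolding sum_distrib_left
    by (intro sum.cong refl arg_cong2[where f=sum]) (auto simp: mult.commute)
  finally have Q: "Q = (\<Sum>f\<in>{f\<in>I. v \<in> S f}. w f * (\<Sum>e\<in>{e\<in>I. v \<notin> S e \<and> S e \<inter> S f \<noteq> {}}. w e))" .
  have b: "(\<Sum>e\<in>{e\<in>I. v \<notin> S e \<and> S e \<inter> S f \<noteq> {}}. w e) \<le> (\<Sum>u\<in>S f - {v}. wdeg I S w u)"
    "(\<Sum>u\<in>S f - {v}. wdeg I S w u)
      \<le> (\<Sum>e\<in>{e\<in>I. v \<notin> S e \<and> S e \<inter> S f \<noteq> {}}. w e) + real t ^ 2 * \<gamma>"
    if f: "f \<in> {f\<in>I. v \<in> S f}" for f
    unfolding wdeg_def using f w \<gamma> codeg[unfolded wcodeg_def] SV[of f]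
    by (intro inter_weight_bounds[OF finI, of "S f" t] finS cardS; auto)+
  show "Q \<le> q"
    unfolding Q q_def using b w by (intro sum_mono mult_left_mono) auto
  have "q \<le> (\<Sum>f\<in>{f\<in>I. v \<in> S f}. w f * ((\<Sum>e\<in>{e\<in>I. v \<notin> S e \<and> S e \<inter> S f \<noteq> {}}. w e) + real t ^ 2 * \<gamma>))"
    unfolding q_def using b w by (intro sum_mono mult_left_mono) auto
  also have "\<dots> = Q + wdeg I S w v * (real t ^ 2 * \<gamma>)"
    unfolding Q by (simp only: distrib_left sum.distrib wdeg_def sum_distrib_right)
  also have "\<dots> \<le> Q + real t ^ 2 * \<gamma>"
    using deg[OF v] \<gamma> wdeg_nonneg by (simp add: mult_left_le_one_le)
  finally show "q \<le> Q + real t ^ 2 * \<gamma>" .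
qed


lemma wdeg_remove: "wdeg {i\<in>I. S i \<inter> S e = {}} S w v = wdeg I S w v - loss e v"
proof -
  have eq: "{i\<in>I. v \<in> S i} = {i\<in>{i\<in>I. S i \<inter> S e = {}}. v \<in> S i} \<union> {i\<in>I. v \<in> S i \<and> S i \<inter> S e \<noteq> {}}"
    by auto
  have "wdeg I S w v = wdeg {i\<in>I. S i \<inter> S e = {}} S w v + loss e v"
    unfolding wdeg_def loss_def eq using finI
    by (subst sum.union_disjoint) (auto simp: conj_commute)
  then show ?thesis by simp
qed

text \<open>Degrees decay like the \<open>(t - 1)\<close>-st power of the number \<open>N\<close> of remaining vertices, whence the
  factor \<open>1 - t (t - 1) / N\<close> for the removal of \<open>t\<close> vertices.\<close>

lemma exists_good_edge:
  fixes D :: real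
  assumes V: "V \<noteq> {}" and D: "0 \<le> D" "D \<le> 1"
  defines "N \<equiv> real (card V)" and "W \<equiv> \<Sum>i\<in>I. w i"
    and "\<Phi> \<equiv> \<Sum>v\<in>V. (wdeg I S w v - D)\<^sup>2"
  assumes W: "W > 0"
  shows "\<exists>e\<in>I. (\<Sum>v\<in>V - S e. (wdeg {i\<in>I. S i \<inter> S e = {}} S w v - D * (1 - real t * (real t - 1) / N))\<^sup>2)
    \<le> \<Phi> + (2 * \<Phi> + 2 * N * real t ^ 2 * \<gamma> + 2 * real t ^ 2) / W + 2 * real t ^ 4 / N + 2 * real t ^ 3 * \<gamma>"
proof -
  define c where "c = real t * (real t - 1) / N"
  define x where "x v = wdeg I S w v - D" for v
  define X where "X = (\<Sum>v\<in>V. x v)"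
  \<comment> \<open>\<open>Q v\<close> is the loss at \<open>v\<close> summed over the sets avoiding
    \<open>v\<close>, with weights. Its main term is \<open>(t - 1) * D * wdeg v\<close>, the
    correction linear in the deviations \<open>x\<close> is \<open>q v\<close>, and
    \<open>r v\<close> is the remainder that codegrees control.\<close>
  define Q where "Q v = (\<Sum>e\<in>{e\<in>I. v \<notin> S e}. w e * loss e v)" for v
  define q where "q v = (\<Sum>f\<in>{f\<in>I. v \<in> S f}. w f * (\<Sum>u\<in>S f - {v}. x u))" for v
  define r where "r v = (real t - 1) * D * wdeg I S w v + q v - Q v" for v
  have N: "N > 0" using V finV by (simp add: N_def card_gt_0_iff)
  have c0: "0 \<le> c" using N t by (simp add: c_def)
  have cN: "c * N \<le> real t ^ 2"
    using N t by (simp add: c_def power2_eq_square)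
  have \<Phi>: "\<Phi> = (\<Sum>v\<in>V. (x v)\<^sup>2)" by (simp add: \<Phi>_def x_def)
  have wd: "wdeg I S w v = D + x v" for v by (simp add: x_def)
  have absx: "\<bar>x v\<bar> \<le> 1" if "v \<in> V" for v
    using deg[OF that] wdeg_nonneg[of v] D unfolding x_def by auto
  have r: "0 \<le> r v" "r v \<le> real t ^ 2 * \<gamma>" if v: "v \<in> V" for v
  proof -
    have "(\<Sum>f\<in>{f\<in>I. v \<in> S f}. w f * (\<Sum>u\<in>S f - {v}. wdeg I S w u))
        = (\<Sum>f\<in>{f\<in>I. v \<in> S f}. w f * ((real t - 1) * D + (\<Sum>u\<in>S f - {v}. x u)))"
    proof (intro sum.cong refl arg_cong2[where f="(*)"])
      fix f assume f: "f \<in> {f\<in>I. v \<in> S f}"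
      then have "card (S f - {v}) = t - 1" using cardS finS by auto
      then show "(\<Sum>u\<in>S f - {v}. wdeg I S w u) = (real t - 1) * D + (\<Sum>u\<in>S f - {v}. x u)"
        unfolding wd using t by (simp add: sum.distrib of_nat_diff)
    qed
    also have "\<dots> = (real t - 1) * D * wdeg I S w v + q v"
      unfolding q_def wdeg_def by (simp add: distrib_left sum.distrib sum_distrib_left mult.commute)
    finally show "0 \<le> r v" "r v \<le> real t ^ 2 * \<gamma>"
      using averaged_loss[OF v] unfolding r_def Q_def by auto
  qed
  have tW: "real t * W = N * D + X"
    using total_weight unfolding W_def wd X_def by (simp add: sum.distrib N_def)
  \<comment> \<open>\<open>A e\<close> is the potential after the choice of \<open>e\<close>, and
    \<open>L e\<close> is its cross term. The remaining quadratic term is small for every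
    \<open>e\<close>, so only \<open>L\<close> needs to be averaged.\<close>
  define A where "A e = (\<Sum>v\<in>V - S e. (x v + (c * D - loss e v))\<^sup>2)" for e
  define L where "L e = (\<Sum>v\<in>V - S e. 2 * x v * (c * D - loss e v))" for e
  have A_le: "A e \<le> \<Phi> + L e + (2 * real t ^ 4 / N + 2 * real t ^ 3 * \<gamma>)" if e: "e \<in> I" for e
  proof -
    have "A e = (\<Sum>v\<in>V - S e. (x v)\<^sup>2) + L e + (\<Sum>v\<in>V - S e. (c * D - loss e v)\<^sup>2)"
      unfolding A_def L_def sum.distrib[symmetric] power2_sum by (simp add: algebra_simps)
    moreover have "(\<Sum>v\<in>V - S e. (x v)\<^sup>2) \<le> \<Phi>"
      unfolding \<Phi> using finV by (intro sum_mono2) auto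
    moreover have "(\<Sum>v\<in>V - S e. (c * D - loss e v)\<^sup>2) \<le> 2 * real t ^ 4 / N + 2 * real t ^ 3 * \<gamma>"
    proof -
      have "(\<Sum>v\<in>V - S e. (c * D - loss e v)\<^sup>2) \<le> (\<Sum>v\<in>V - S e. 2 * (c * D)\<^sup>2 + 2 * (loss e v)\<^sup>2)"
      proof (rule sum_mono)
        fix v
        have "0 \<le> (c * D + loss e v)\<^sup>2" by simp
        then show "(c * D - loss e v)\<^sup>2 \<le> 2 * (c * D)\<^sup>2 + 2 * (loss e v)\<^sup>2"
          by (simp add: power2_eq_square algebra_simps)
      qed
      also have "\<dots> = real (card (V - S e)) * (2 * (c * D)\<^sup>2) + 2 * (\<Sum>v\<in>V - S e. (loss e v)\<^sup>2)"
        by (simp add: sum.distrib sum_distrib_left)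
      also have "\<dots> \<le> N * (2 * (c * D)\<^sup>2) + 2 * (real t ^ 3 * \<gamma>)"
        unfolding N_def using finV
        by (intro add_mono mult_right_mono mult_left_mono sum_loss_square e) (auto intro: card_mono)
      also have "N * (2 * (c * D)\<^sup>2) \<le> 2 * real t ^ 4 / N"
      proof -
        have "c * D \<le> c" using c0 D by (simp add: mult_left_le)
        then have "N * (c * D) \<le> real t ^ 2"
          using N cN by (smt (verit) mult.commute mult_left_mono)
        then have "(N * (c * D))\<^sup>2 \<le> (real t ^ 2)\<^sup>2"
          using N c0 D by (intro power_mono) auto
        then show ?thesis using N by (simp add: field_simps power2_eq_square power4_eq_xxxx)
      qed
      finally show ?thesis by simp
    qed
    ultimately show ?thesis by linarith
  qed
  have "(\<Sum>e\<in>I. w e * L e) = (\<Sum>e\<in>I. \<Sum>v\<in>{v\<in>V. v \<notin> S e}. w e * (2 * x v * (c * D - loss e v)))"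
    unfolding L_def sum_distrib_left
    by (intro sum.cong refl arg_cong2[where f=sum]) auto
  also have "\<dots> = (\<Sum>v\<in>V. \<Sum>e\<in>{e\<in>I. v \<notin> S e}. w e * (2 * x v * (c * D - loss e v)))"
    by (rule sum.swap_restrict[OF finI finV])
  also have "\<dots> = (\<Sum>v\<in>V. 2 * x v * (c * D * (W - wdeg I S w v) - Q v))"
  proof (intro sum.cong refl)
    fix v
    have "W = wdeg I S w v + (\<Sum>e\<in>{e\<in>I. v \<notin> S e}. w e)"
    proof -
      have eq: "I = {e\<in>I. v \<in> S e} \<union> {e\<in>I. v \<notin> S e}" by auto
      show ?thesis unfolding W_def wdeg_def
        by (subst eq, subst sum.union_disjoint) (use finI in auto)
    qed
    then have W': "W - wdeg I S w v = (\<Sum>e\<in>{e\<in>I. v \<notin> S e}. w e)" by simp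
    show "(\<Sum>e\<in>{e\<in>I. v \<notin> S e}. w e * (2 * x v * (c * D - loss e v)))
        = 2 * x v * (c * D * (W - wdeg I S w v) - Q v)"
      unfolding W' Q_def
      by (simp add: right_diff_distrib sum_subtractf sum_distrib_left sum_distrib_right mult_ac)
  qed
  \<comment> \<open>Three parts: a drift towards the mean, the interaction of deviations inside one
    set, and a remainder.\<close>
  also have "\<dots> = (\<Sum>v\<in>V. 2 * x v * (c * D * W - (real t - 1) * D * (D + x v)))
      + - (2 * (\<Sum>v\<in>V. x v * q v)) + (\<Sum>v\<in>V. 2 * x v * (r v - c * D * wdeg I S w v))"
  proof -
    have "2 * x v * (c * D * (W - wdeg I S w v) - Q v)
       = 2 * x v * (c * D * W - (real t - 1) * D * (D + x v)) + - (2 * (x v * q v))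
        + 2 * x v * (r v - c * D * wdeg I S w v)" for v
      unfolding r_def wd by (simp add: algebra_simps)
    then show ?thesis by (simp only: sum.distrib sum_negf sum_distrib_left)
  qed
  also have "\<dots> \<le> 0 + 2 * \<Phi> + (2 * N * real t ^ 2 * \<gamma> + 2 * real t ^ 2)"
  proof (intro add_mono)
    \<comment> \<open>By \<open>tW\<close>, \<open>D + X / N\<close> is the mean degree. The decay
      factor was chosen to match it, so the drift is a negative multiple of the variance of
      \<open>x\<close>.\<close>
    have cDW: "c * D * W = (real t - 1) * D * (D + X / N)"
    proof -
      have "c * D * W = (real t - 1) * D * (real t * W) / N" by (simp add: c_def)
      also have "\<dots> = (real t - 1) * D * (D + X / N)"
        unfolding tW using N by (simp add: field_simps)
      finally show ?thesis .
    qed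
    have "2 * x v * (c * D * W - (real t - 1) * D * (D + x v))
        = 2 * (real t - 1) * D * (X / N * x v - (x v)\<^sup>2)" for v
      unfolding cDW by (simp add: algebra_simps power2_eq_square)
    then have "(\<Sum>v\<in>V. 2 * x v * (c * D * W - (real t - 1) * D * (D + x v)))
        = 2 * (real t - 1) * D * (X / N * X - \<Phi>)"
      unfolding \<Phi> by (simp only: sum_distrib_left[symmetric] sum_subtractf X_def[symmetric])
    also have "\<dots> \<le> 0"
    proof -
      have "X\<^sup>2 \<le> N * \<Phi>"
        using sum_squared_le_sum_of_squares[of x V] finV unfolding X_def \<Phi> N_def by (simp add: mult.commute)
      then have "X / N * X \<le> \<Phi>" using N by (simp add: field_simps power2_eq_square)
      then show ?thesis using t D by (intro mult_nonneg_nonpos) auto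
    qed
    finally show "(\<Sum>v\<in>V. 2 * x v * (c * D * W - (real t - 1) * D * (D + x v))) \<le> 0" .
    \<comment> \<open>Inside each set the products over distinct points equal the square of the sum
      minus the sum of the squares. Dropping the first square costs at most \<open>\<Phi>\<close>,
      since degrees are at most 1.\<close>
    have "(\<Sum>v\<in>V. x v * q v) = (\<Sum>v\<in>V. \<Sum>f\<in>{f\<in>I. v \<in> S f}. w f * (x v * (\<Sum>u\<in>S f - {v}. x u)))"
      unfolding q_def sum_distrib_left by (simp add: mult_ac)
    also have "\<dots> = (\<Sum>f\<in>I. \<Sum>v\<in>{v\<in>V. v \<in> S f}. w f * (x v * (\<Sum>u\<in>S f - {v}. x u)))"
      by (rule sum.swap_restrict[OF finV finI])
    also have "\<dots> = (\<Sum>f\<in>I. w f * ((\<Sum>v\<in>S f. x v)\<^sup>2 - (\<Sum>v\<in>S f. (x v)\<^sup>2)))"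
    proof (intro sum.cong refl)
      fix f assume f: "f \<in> I"
      then have eq: "{v\<in>V. v \<in> S f} = S f" using SV by auto
      have "(\<Sum>v\<in>S f. x v * (\<Sum>u\<in>S f - {v}. x u)) = (\<Sum>v\<in>S f. x v * ((\<Sum>u\<in>S f. x u) - x v))"
        by (intro sum.cong refl arg_cong2[where f="(*)"]) (use finS[OF f] in \<open>auto simp: sum_diff1\<close>)
      also have "\<dots> = (\<Sum>v\<in>S f. x v)\<^sup>2 - (\<Sum>v\<in>S f. (x v)\<^sup>2)"
        by (simp add: right_diff_distrib sum_subtractf power2_eq_square flip: sum_distrib_right)
      finally show "(\<Sum>v\<in>{v\<in>V. v \<in> S f}. w f * (x v * (\<Sum>u\<in>S f - {v}. x u)))
         = w f * ((\<Sum>v\<in>S f. x v)\<^sup>2 - (\<Sum>v\<in>S f. (x v)\<^sup>2))"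
        unfolding eq by (simp flip: sum_distrib_left)
    qed
    also have "\<dots> \<ge> (\<Sum>f\<in>I. w f * (- (\<Sum>v\<in>S f. (x v)\<^sup>2)))"
      using w by (intro sum_mono mult_left_mono) auto
    finally have "- (\<Sum>v\<in>V. x v * q v) \<le> (\<Sum>f\<in>I. w f * (\<Sum>v\<in>S f. (x v)\<^sup>2))"
      by (simp add: sum_negf)
    also have "\<dots> = (\<Sum>v\<in>V. (x v)\<^sup>2 * wdeg I S w v)"
      by (rule sum_wdeg[OF finV finI SV, symmetric])
    also have "\<dots> \<le> \<Phi>"
      unfolding \<Phi> using deg by (intro sum_mono mult_left_le) auto
    finally show "- (2 * (\<Sum>v\<in>V. x v * q v)) \<le> 2 * \<Phi>" by simp
    have "(\<Sum>v\<in>V. 2 * x v * (r v - c * D * wdeg I S w v)) \<le> (\<Sum>v\<in>V. 2 * (real t ^ 2 * \<gamma> + c))"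
    proof (rule sum_mono)
      fix v assume v: "v \<in> V"
      have "D * wdeg I S w v \<le> 1" using D deg[OF v] wdeg_nonneg[of v] by (simp add: mult_le_one)
      then have "c * D * wdeg I S w v \<le> c" "0 \<le> c * D * wdeg I S w v"
        using c0 D wdeg_nonneg[of v] by (auto simp: mult.assoc mult_left_le)
      then have "\<bar>r v - c * D * wdeg I S w v\<bar> \<le> real t ^ 2 * \<gamma> + c"
        using r[OF v] c0 by linarith
      then have "\<bar>x v\<bar> * \<bar>r v - c * D * wdeg I S w v\<bar> \<le> 1 * (real t ^ 2 * \<gamma> + c)"
        by (intro mult_mono absx v) auto
      then have "x v * (r v - c * D * wdeg I S w v) \<le> real t ^ 2 * \<gamma> + c"
        by (metis abs_ge_self abs_mult mult_1 order_trans)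
      then show "2 * x v * (r v - c * D * wdeg I S w v) \<le> 2 * (real t ^ 2 * \<gamma> + c)" by simp
    qed
    also have "\<dots> = 2 * N * real t ^ 2 * \<gamma> + 2 * (c * N)"
      by (simp add: N_def algebra_simps)
    finally show "(\<Sum>v\<in>V. 2 * x v * (r v - c * D * wdeg I S w v)) \<le> 2 * N * real t ^ 2 * \<gamma> + 2 * real t ^ 2"
      using cN by linarith
  qed
  finally have L: "(\<Sum>e\<in>I. w e * L e) \<le> 2 * \<Phi> + 2 * N * real t ^ 2 * \<gamma> + 2 * real t ^ 2" by simp
  define R where "R = \<Phi> + (2 * \<Phi> + 2 * N * real t ^ 2 * \<gamma> + 2 * real t ^ 2) / W + 2 * real t ^ 4 / N + 2 * real t ^ 3 * \<gamma>"
  have "(\<Sum>e\<in>I. w e * A e) \<le> (\<Sum>e\<in>I. w e * (\<Phi> + L e + (2 * real t ^ 4 / N + 2 * real t ^ 3 * \<gamma>)))"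
    by (intro sum_mono mult_left_mono A_le w)
  also have "\<dots> = W * \<Phi> + (\<Sum>e\<in>I. w e * L e) + W * (2 * real t ^ 4 / N + 2 * real t ^ 3 * \<gamma>)"
    unfolding W_def by (simp only: distrib_left sum.distrib sum_distrib_right)
  also have "\<dots> \<le> W * R"
  proof -
    have "W * R = W * \<Phi> + (2 * \<Phi> + 2 * N * real t ^ 2 * \<gamma> + 2 * real t ^ 2)
        + W * (2 * real t ^ 4 / N + 2 * real t ^ 3 * \<gamma>)"
      unfolding R_def distrib_left using W by simp
    then show ?thesis using L by simp
  qed
  finally obtain e where e: "e \<in> I" "A e \<le> R"
    using weighted_average_le[where I = I and w = w and A = A and R = R] finI w W unfolding W_def by blast
  have "A e = (\<Sum>v\<in>V - S e. (wdeg {i\<in>I. S i \<inter> S e = {}} S w v - D * (1 - real t * (real t - 1) / N))\<^sup>2)"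
    unfolding A_def wdeg_remove c_def[symmetric] x_def by (simp add: algebra_simps)
  then show ?thesis using e unfolding R_def by auto
qed

lemma restrict:
  assumes "V' \<subseteq> V"
  shows "weighted_family V' {i\<in>I. S i \<subseteq> V'} S w t \<gamma>"
proof -
  have mono: "wdeg {i\<in>I. S i \<subseteq> V'} S w v \<le> wdeg I S w v" for v
    unfolding wdeg_def using finI w by (intro sum_mono2) auto
  have comono: "wcodeg {i\<in>I. S i \<subseteq> V'} S w u v \<le> wcodeg I S w u v" for u v
    unfolding wcodeg_def using finI w by (intro sum_mono2) auto
  show ?thesis
  proof unfold_locales
    show "wdeg {i\<in>I. S i \<subseteq> V'} S w v \<le> 1" if "v \<in> V'" for v
      using order_trans[OF mono deg] that assms by auto
    show "wcodeg {i\<in>I. S i \<subseteq> V'} S w u v \<le> \<gamma>" if "u \<in> V'" "v \<in> V'" "u \<noteq> v" for u v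
      using order_trans[OF comono codeg] that assms by blast
  qed (use assms finV finI finite_subset w cardS t \<gamma> in auto)
qed

section \<open>Iterating the greedy step\<close>

definition deviation :: "'b set \<Rightarrow> real \<Rightarrow> real" where
  "deviation V' D = (\<Sum>v\<in>V'. (wdeg {i\<in>I. S i \<subseteq> V'} S w v - D)\<^sup>2)"

text \<open>A small deviation keeps the total weight \<open>W\<close> of order \<open>n\<close>: by
  Cauchy-Schwarz the degree sum differs from \<open>N * D \<ge> \<epsilon> * \<delta> * n\<close> by
  at most half of that lower bound, whence \<open>W \<ge> \<beta> * n\<close>. The increase allowed
  by \<open>exists_good_edge\<close>, which involves \<open>1 / W\<close>, thus becomes
  explicit.\<close>

lemma deviation_step:
  fixes D \<epsilon> \<delta> :: real
  assumes V': "V' \<subseteq> V" and D: "\<delta> \<le> D" "D \<le> 1" and \<epsilon>: "\<epsilon> > 0" and \<delta>: "\<delta> > 0"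
    and n: "real (card V) = n" "n > 0" "real t ^ 2 / (\<epsilon> * n) \<le> 1 / 2"
    and N: "\<epsilon> * n \<le> real (card V')"
    and small: "deviation V' D \<le> (\<epsilon> * \<delta> / 2)\<^sup>2 * n"
  defines "\<beta> \<equiv> \<epsilon> * \<delta> / (2 * real t)"
  shows "\<exists>e\<in>I. S e \<subseteq> V' \<and> (\<exists>D'\<ge>D * exp (- 2 * (real t ^ 2 / (\<epsilon> * n))). D' \<le> 1 \<and>
    deviation (V' - S e) D' \<le> deviation V' D * (1 + 2 / (\<beta> * n)) +
      ((2 * real t ^ 2 * \<gamma> + 2 * real t ^ 2 / n) / \<beta> + 2 * real t ^ 4 / (\<epsilon> * n) + 2 * real t ^ 3 * \<gamma>))"
proof -
  define I' where "I' = {i\<in>I. S i \<subseteq> V'}"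
  interpret r: weighted_family V' I' S w t \<gamma> unfolding I'_def by (rule restrict[OF V'])
  define N where "N = real (card V')"
  define W where "W = (\<Sum>i\<in>I'. w i)"
  define \<Phi> where "\<Phi> = deviation V' D"
  have \<Phi>_eq: "\<Phi> = (\<Sum>v\<in>V'. (wdeg I' S w v - D)\<^sup>2)"
    unfolding \<Phi>_def deviation_def I'_def ..
  have D0: "0 < D" using D \<delta> by simp
  have N0: "\<epsilon> * n \<le> N" using N by (simp add: N_def)
  have en: "0 < \<epsilon> * n" using \<epsilon> n by simp
  have Npos: "0 < N" using N0 en by linarith
  have Nn: "N \<le> n" unfolding N_def n(1)[symmetric] using card_mono[OF finV V'] by simp
  have ne: "V' \<noteq> {}" using Npos by (auto simp: N_def)
  have \<Phi>0: "0 \<le> \<Phi>" unfolding \<Phi>_eq by (intro sum_nonneg) auto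
  have t0: "real t \<ge> 1" using t by simp
  have \<beta>: "\<beta> > 0" using \<epsilon> \<delta> t0 by (simp add: \<beta>_def)
  define X where "X = (\<Sum>v\<in>V'. wdeg I' S w v - D)"
  have tW: "real t * W = N * D + X"
    unfolding W_def X_def r.total_weight[symmetric] by (simp add: sum_subtractf N_def)
  have "X\<^sup>2 \<le> N * \<Phi>"
    using sum_squared_le_sum_of_squares[of "\<lambda>v. wdeg I' S w v - D" V'] r.finV
    unfolding X_def \<Phi>_eq N_def by (simp add: mult.commute)
  also have "\<dots> \<le> n * ((\<epsilon> * \<delta> / 2)\<^sup>2 * n)"
    using small Nn n \<Phi>0 unfolding \<Phi>_def by (intro mult_mono) auto
  also have "\<dots> = (\<epsilon> * \<delta> / 2 * n)\<^sup>2" by (simp add: power2_eq_square)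
  finally have "\<bar>X\<bar> \<le> \<epsilon> * \<delta> / 2 * n"
    using \<epsilon> \<delta> n by (simp add: abs_le_square_iff[symmetric])
  moreover have "\<epsilon> * n * \<delta> \<le> N * D" using N0 D \<delta> en Npos by (intro mult_mono) auto
  ultimately have "\<epsilon> * n * \<delta> / 2 \<le> real t * W" unfolding tW by (simp add: mult_ac)
  then have W: "\<beta> * n \<le> W" using t0 unfolding \<beta>_def by (simp add: field_simps)
  have bn: "0 < \<beta> * n" using \<beta> n by simp
  then have W0: "0 < W" using W by linarith
  obtain e where e: "e \<in> I'" and le: "(\<Sum>v\<in>V' - S e. (wdeg {i\<in>I'. S i \<inter> S e = {}} S w v
        - D * (1 - real t * (real t - 1) / N))\<^sup>2)
      \<le> \<Phi> + (2 * \<Phi> + 2 * N * real t ^ 2 * \<gamma> + 2 * real t ^ 2) / W + 2 * real t ^ 4 / N + 2 * real t ^ 3 * \<gamma>"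
    using r.exists_good_edge[OF ne less_imp_le[OF D0] D(2)] W0 unfolding W_def \<Phi>_eq N_def by auto
  define D' where "D' = D * (1 - real t * (real t - 1) / N)"
  have "{i\<in>I'. S i \<inter> S e = {}} = {i\<in>I. S i \<subseteq> V' - S e}" unfolding I'_def by auto
  then have "deviation (V' - S e) D'
      \<le> \<Phi> + (2 * \<Phi> + 2 * N * real t ^ 2 * \<gamma> + 2 * real t ^ 2) / W + 2 * real t ^ 4 / N + 2 * real t ^ 3 * \<gamma>"
    using le unfolding deviation_def D'_def by simp
  also have "\<dots> \<le> \<Phi> + (2 * \<Phi> + 2 * n * real t ^ 2 * \<gamma> + 2 * real t ^ 2) / (\<beta> * n)
      + 2 * real t ^ 4 / (\<epsilon> * n) + 2 * real t ^ 3 * \<gamma>"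
    using W W0 bn \<Phi>0 Nn \<gamma> N0 en Npos
    by (intro add_mono frac_le mult_right_mono order_refl) (auto intro!: add_nonneg_nonneg mult_nonneg_nonneg)
  also have "\<dots> = \<Phi> * (1 + 2 / (\<beta> * n)) +
      ((2 * real t ^ 2 * \<gamma> + 2 * real t ^ 2 / n) / \<beta> + 2 * real t ^ 4 / (\<epsilon> * n) + 2 * real t ^ 3 * \<gamma>)"
    using \<beta> n(2) by (simp add: field_simps)
  finally have dev: "deviation (V' - S e) D' \<le> \<dots>" .
  have x: "0 \<le> real t * (real t - 1) / N" using t0 Npos by simp
  have "real t * (real t - 1) / N \<le> real t ^ 2 / (\<epsilon> * n)"
    using t0 N0 en by (intro frac_le) (auto simp: power2_eq_square)
  then have "exp (- 2 * (real t ^ 2 / (\<epsilon> * n))) \<le> exp (- 2 * (real t * (real t - 1) / N))" by simp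
  also have "\<dots> \<le> 1 - real t * (real t - 1) / N"
    using x \<open>_ \<le> real t ^ 2 / (\<epsilon> * n)\<close> n(3) by (intro exp_le_one_minus) linarith+
  finally have "D' \<ge> D * exp (- 2 * (real t ^ 2 / (\<epsilon> * n)))"
    unfolding D'_def using D0 by (intro mult_left_mono) auto
  moreover have "D' \<le> 1"
    unfolding D'_def using x D D0 \<open>_ \<le> 1 - real t * (real t - 1) / N\<close>
      order_trans[OF exp_ge_zero \<open>_ \<le> 1 - real t * (real t - 1) / N\<close>]
    by (intro mult_le_one) linarith+
  ultimately show ?thesis
    using e dev unfolding I'_def \<Phi>_def by blast
qed

text \<open>Each step removes \<open>t \<ge> 1\<close> vertices, so there are at most
  \<open>n\<close> steps. Over these the factors \<open>1 + 2 / (\<beta> * n)\<close> multiply to at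
  most \<open>exp (2 / \<beta>)\<close>, the expected degree stays above \<open>\<delta>\<close>,
  and the additive errors sum to at most \<open>n\<close> times a single one before this
  amplification. The last hypothesis keeps the potential below the threshold of
  \<open>deviation_step\<close> throughout.\<close>

lemma greedy_matching:
  fixes \<epsilon> \<eta> :: real
  assumes \<epsilon>: "\<epsilon> > 0" and n: "real (card V) = n" "n > 0" "real t ^ 2 / (\<epsilon> * n) \<le> 1 / 2"
    and start: "(\<Sum>v\<in>V. 1 - wdeg I S w v) \<le> \<eta> * n"
  defines "\<delta> \<equiv> exp (- 2 * real t ^ 2 / \<epsilon>)"
  defines "\<beta> \<equiv> \<epsilon> * \<delta> / (2 * real t)"
  assumes err: "exp (2 / \<beta>) * (\<eta> + ((2 * real t ^ 2 * \<gamma> + 2 * real t ^ 2 / n) / \<beta>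
      + 2 * real t ^ 4 / (\<epsilon> * n) + 2 * real t ^ 3 * \<gamma>)) \<le> (\<epsilon> * \<delta> / 2)\<^sup>2"
  shows "\<exists>M\<subseteq>I. disjoint_family_on S M \<and> real (card (\<Union>(S ` M))) \<ge> (1 - \<epsilon>) * n"
proof -
  define err where "err = (2 * real t ^ 2 * \<gamma> + 2 * real t ^ 2 / n) / \<beta>
      + 2 * real t ^ 4 / (\<epsilon> * n) + 2 * real t ^ 3 * \<gamma>"
  define a where "a = 2 / (\<beta> * n)"
  have t0: "real t \<ge> 1" using t by simp
  have \<delta>: "\<delta> > 0" by (simp add: \<delta>_def)
  have \<beta>: "\<beta> > 0" using \<epsilon> \<delta> t0 by (simp add: \<beta>_def)
  have a0: "a \<ge> 0" using \<beta> n by (simp add: a_def)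
  have err0: "err \<ge> 0" unfolding err_def using \<beta> n \<gamma> \<epsilon> by (intro add_nonneg_nonneg divide_nonneg_nonneg mult_nonneg_nonneg) auto
  have \<eta>0: "\<eta> * n \<ge> 0"
    using start deg by (intro order_trans[OF sum_nonneg start]) auto
  have P: "\<exists>M\<subseteq>I. disjoint_family_on S M \<and> real (card (V - \<Union>(S ` M))) = n - real t * real j \<and>
      (\<exists>D\<ge>exp (- 2 * (real t ^ 2 / (\<epsilon> * n)) * real j). D \<le> 1 \<and>
         deviation (V - \<Union>(S ` M)) D \<le> (1 + a) ^ j * (\<eta> * n + real j * err))"
    if "\<forall>i<j. \<epsilon> * n < n - real t * real i" for j
    using that
  proof (induction j)
    case 0
    \<comment> \<open>The target degree starts at 1. As \<open>(1 - d)^2 \<le> 1 - d\<close> for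
      \<open>d\<close> between 0 and 1, the hypothesis on the total deficit bounds the initial
      potential.\<close>
    have "deviation V 1 \<le> (\<Sum>v\<in>V. 1 - wdeg I S w v)"
      unfolding deviation_def
    proof (rule sum_mono)
      fix v assume v: "v \<in> V"
      have "{i\<in>I. S i \<subseteq> V} = I" using SV by auto
      moreover have "(1 - wdeg I S w v)\<^sup>2 \<le> (1 - wdeg I S w v) * 1"
        unfolding power2_eq_square using deg[OF v] wdeg_nonneg[of v] by (intro mult_left_mono) auto
      ultimately show "(wdeg {i\<in>I. S i \<subseteq> V} S w v - 1)\<^sup>2 \<le> 1 - wdeg I S w v"
        by (simp add: power2_commute)
    qed
    then have "deviation V 1 \<le> \<eta> * n" using start by linarith
    then show ?case
      using n by (intro exI[of _ "{}"]) (auto simp: disjoint_family_on_def intro!: exI[of _ 1])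
  next
    case (Suc j)
    then obtain M D where M: "M \<subseteq> I" "disjoint_family_on S M"
      and cardM: "real (card (V - \<Union>(S ` M))) = n - real t * real j"
      and D: "exp (- 2 * (real t ^ 2 / (\<epsilon> * n)) * real j) \<le> D" "D \<le> 1"
      and dev: "deviation (V - \<Union>(S ` M)) D \<le> (1 + a) ^ j * (\<eta> * n + real j * err)"
      by auto
    define V' where "V' = V - \<Union>(S ` M)"
    have V': "V' \<subseteq> V" by (auto simp: V'_def)
    have N: "\<epsilon> * n < real (card V')" using Suc.prems cardM by (auto simp: V'_def)
    have "0 < \<epsilon> * n" using \<epsilon> n by simp
    then have "real t * real j \<le> n" using N cardM unfolding V'_def by linarith
    moreover have "1 * real j \<le> real t * real j" using t0 by (intro mult_right_mono) auto
    ultimately have jn: "real j \<le> n" by linarith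
    have "\<delta> \<le> exp (- 2 * (real t ^ 2 / (\<epsilon> * n)) * real j)"
    proof -
      have "2 * (real t ^ 2 / (\<epsilon> * n)) * real j \<le> 2 * (real t ^ 2 / (\<epsilon> * n)) * n"
        using \<epsilon> n(2) jn by (intro mult_left_mono) auto
      also have "\<dots> = 2 * real t ^ 2 / \<epsilon>" using n(2) by simp
      finally show ?thesis by (simp add: \<delta>_def)
    qed
    then have D\<delta>: "\<delta> \<le> D" using D by linarith
    have small: "deviation V' D \<le> (\<epsilon> * \<delta> / 2)\<^sup>2 * n"
    proof -
      have "(1 + a) ^ j \<le> exp a ^ j" using a0 by (intro power_mono) auto
      also have "\<dots> = exp (real j * a)" by (simp add: exp_of_nat_mult)
      also have "\<dots> \<le> exp (n * a)" using jn a0 by (simp add: mult_right_mono)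
      also have "n * a = 2 / \<beta>" using n(2) by (simp add: a_def)
      finally have "(1 + a) ^ j * (\<eta> * n + real j * err) \<le> exp (2 / \<beta>) * (\<eta> * n + n * err)"
        using a0 err0 \<eta>0 jn by (intro mult_mono add_mono mult_right_mono) auto
      also have "\<dots> = exp (2 / \<beta>) * (\<eta> + err) * n" by (simp add: algebra_simps)
      also have "\<dots> \<le> (\<epsilon> * \<delta> / 2)\<^sup>2 * n"
        using err n(2) unfolding err_def by (intro mult_right_mono) auto
      finally show ?thesis using dev unfolding V'_def by linarith
    qed
    obtain e D' where e: "e \<in> I" "S e \<subseteq> V'"
      and D': "D * exp (- 2 * (real t ^ 2 / (\<epsilon> * n))) \<le> D'" "D' \<le> 1"
      and dev': "deviation (V' - S e) D' \<le> deviation V' D * (1 + 2 / (\<beta> * n)) + err"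
      using deviation_step[OF V' D\<delta> D(2) \<epsilon> \<delta> n less_imp_le[OF N] small] unfolding \<beta>_def err_def
      by blast
    have V'': "V' - S e = V - \<Union>(S ` insert e M)" unfolding V'_def by auto
    have "disjoint_family_on S (insert e M)"
      using M e unfolding disjoint_family_on_def V'_def by blast
    moreover have "real (card (V' - S e)) = n - real t * real (Suc j)"
    proof -
      have "card (V' - S e) = card V' - t" "t \<le> card V'"
        using e V' finV finite_subset cardS[OF e(1)] card_mono[of V' "S e"]
        by (auto simp: card_Diff_subset finS)
      then show ?thesis using cardM unfolding V'_def[symmetric] by (simp add: of_nat_diff algebra_simps)
    qed
    moreover have "exp (- 2 * (real t ^ 2 / (\<epsilon> * n)) * real (Suc j)) \<le> D'"
    proof -
      have "exp (- 2 * (real t ^ 2 / (\<epsilon> * n)) * real (Suc j))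
          = exp (- 2 * (real t ^ 2 / (\<epsilon> * n)) * real j) * exp (- 2 * (real t ^ 2 / (\<epsilon> * n)))"
        unfolding exp_add[symmetric] of_nat_Suc by (simp only: distrib_left mult_1_right add.commute)
      also have "\<dots> \<le> D * exp (- 2 * (real t ^ 2 / (\<epsilon> * n)))"
        using D by (intro mult_right_mono) auto
      finally show ?thesis using D' by linarith
    qed
    moreover have "deviation (V' - S e) D' \<le> (1 + a) ^ Suc j * (\<eta> * n + real (Suc j) * err)"
    proof -
      have "deviation V' D * (1 + a) \<le> (1 + a) ^ j * (\<eta> * n + real j * err) * (1 + a)"
        using dev a0 unfolding V'_def by (intro mult_right_mono) auto
      moreover have "1 * err \<le> (1 + a) ^ Suc j * err"
        using err0 a0 by (intro mult_right_mono one_le_power) auto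
      ultimately show ?thesis using dev' unfolding a_def[symmetric] by (simp add: algebra_simps)
    qed
    ultimately show ?case
      unfolding V'' using M(1) e(1) D'(2) by (intro exI[of _ "insert e M"]) auto
  qed
  have "\<exists>j. \<not> \<epsilon> * n < n - real t * real j"
  proof -
    obtain j where "n < real j" using reals_Archimedean2 by blast
    moreover have "1 * real j \<le> real t * real j" using t0 by (intro mult_right_mono) auto
    moreover have "0 < \<epsilon> * n" using \<epsilon> n by simp
    ultimately show ?thesis by (intro exI[of _ j]) linarith
  qed
  then obtain j where j: "n - real t * real j \<le> \<epsilon> * n" "\<forall>i<j. \<epsilon> * n < n - real t * real i"
    using exists_least_iff[of "\<lambda>j. \<not> \<epsilon> * n < n - real t * real j"]
    by (metis not_le_imp_less)
  obtain M where M: "M \<subseteq> I" "disjoint_family_on S M"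
    and cardM: "real (card (V - \<Union>(S ` M))) = n - real t * real j"
    using P[OF j(2)] by blast
  have "\<Union>(S ` M) \<subseteq> V" using M(1) SV by blast
  then have "real (card (\<Union>(S ` M))) = n - real (card (V - \<Union>(S ` M)))"
    using n(1) finV card_mono[OF finV, of "\<Union>(S ` M)"]
    by (simp add: card_Diff_subset finite_subset of_nat_diff)
  then show ?thesis using cardM j(1) M by (intro exI[of _ M]) (auto simp: algebra_simps)
qed

end

theorem almost_perfect_matching:
  fixes \<epsilon> :: real and t :: nat
  assumes \<epsilon>: "\<epsilon> > 0" and t: "t \<ge> 1"
  shows "\<exists>\<eta> \<gamma> n\<^sub>0. \<eta> > 0 \<and> \<gamma> > 0 \<and> n\<^sub>0 > 0 \<and>
    (\<forall>(V :: 'b set) (I :: 'i set) S w. weighted_family V I S w t \<gamma> \<longrightarrow> real (card V) \<ge> n\<^sub>0 \<longrightarrow>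
       (\<Sum>v\<in>V. 1 - wdeg I S w v) \<le> \<eta> * real (card V) \<longrightarrow>
       (\<exists>M\<subseteq>I. disjoint_family_on S M \<and> real (card (\<Union>(S ` M))) \<ge> (1 - \<epsilon>) * real (card V)))"
proof -
  define \<delta> where "\<delta> = exp (- 2 * real t ^ 2 / \<epsilon>)"
  define \<beta> where "\<beta> = \<epsilon> * \<delta> / (2 * real t)"
  \<comment> \<open>The budget that \<open>greedy_matching\<close> leaves for the initial deficit
    plus the error of one step. The deficit receives half of it, and the error terms in
    \<open>\<gamma>\<close> and in \<open>1 / n\<close>, whose coefficients \<open>K\<close>
    collects, a quarter each.\<close>
  define \<sigma> where "\<sigma> = (\<epsilon> * \<delta> / 2)\<^sup>2 / exp (2 / \<beta>)"
  have \<delta>: "\<delta> > 0" by (simp add: \<delta>_def)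
  have \<beta>: "\<beta> > 0" using \<epsilon> \<delta> t by (simp add: \<beta>_def)
  have \<sigma>: "\<sigma> > 0" using \<epsilon> \<delta> by (simp add: \<sigma>_def)
  define K where "K = 2 * real t ^ 2 / \<beta> + 2 * real t ^ 4 / \<epsilon> + 2 * real t ^ 3"
  have K: "K > 0" using \<beta> \<epsilon> t by (simp add: K_def add_pos_pos)
  define \<gamma> where "\<gamma> = \<sigma> / (4 * K)"
  \<comment> \<open>The first entry makes each decay \<open>t^2 / (\<epsilon> * n)\<close> at most
    \<open>1/2\<close>, as \<open>exp_le_one_minus\<close> requires.\<close>
  define n\<^sub>0 where "n\<^sub>0 = max (2 * real t ^ 2 / \<epsilon>) (4 * K / \<sigma>)"
  have n\<^sub>0: "n\<^sub>0 > 0" using K \<sigma> by (simp add: n\<^sub>0_def less_max_iff_disj)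
  have \<gamma>: "\<gamma> > 0" using K \<sigma> by (simp add: \<gamma>_def)
  have main: "\<exists>M\<subseteq>I. disjoint_family_on S M \<and> real (card (\<Union>(S ` M))) \<ge> (1 - \<epsilon>) * real (card V)"
    if fam: "weighted_family V I S w t \<gamma>" and n: "real (card V) \<ge> n\<^sub>0"
      and start: "(\<Sum>v\<in>V. 1 - wdeg I S w v) \<le> \<sigma> / 2 * real (card V)"
    for V :: "'b set" and I :: "'i set" and S w
  proof -
    interpret weighted_family V I S w t \<gamma> by (rule fam)
    define n where "n = real (card V)"
    have npos: "n > 0" using n n\<^sub>0 unfolding n_def by linarith
    have n1: "2 * real t ^ 2 / \<epsilon> \<le> n" "4 * K / \<sigma> \<le> n" using n by (auto simp: n\<^sub>0_def n_def)
    have t2: "real t ^ 2 / (\<epsilon> * n) \<le> 1 / 2" using n1(1) \<epsilon> npos by (simp add: field_simps)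
    have "(2 * real t ^ 2 * \<gamma> + 2 * real t ^ 2 / n) / \<beta> + 2 * real t ^ 4 / (\<epsilon> * n) + 2 * real t ^ 3 * \<gamma>
      \<le> K * \<gamma> + K / n"
    proof -
      have "K * \<gamma> + K / n = (2 * real t ^ 2 * \<gamma> + 2 * real t ^ 2 / n) / \<beta> + 2 * real t ^ 4 / (\<epsilon> * n) + 2 * real t ^ 3 * \<gamma>
         + 2 * real t ^ 4 / \<epsilon> * \<gamma> + 2 * real t ^ 3 / n"
        unfolding K_def by (simp add: add_divide_distrib distrib_right distrib_left mult.commute)
      moreover have "0 \<le> 2 * real t ^ 4 / \<epsilon> * \<gamma>" "0 \<le> 2 * real t ^ 3 / n" using \<epsilon> \<gamma> npos by auto
      ultimately show ?thesis by linarith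
    qed
    moreover have "K * \<gamma> = \<sigma> / 4" using K by (simp add: \<gamma>_def)
    moreover have "K / n \<le> \<sigma> / 4" using n1(2) \<sigma> npos by (simp add: field_simps)
    ultimately have "exp (2 / \<beta>) * (\<sigma> / 2 + ((2 * real t ^ 2 * \<gamma> + 2 * real t ^ 2 / n) / \<beta>
      + 2 * real t ^ 4 / (\<epsilon> * n) + 2 * real t ^ 3 * \<gamma>)) \<le> exp (2 / \<beta>) * \<sigma>"
      by (intro mult_left_mono exp_ge_zero) linarith
    also have "\<dots> = (\<epsilon> * \<delta> / 2)\<^sup>2" by (simp add: \<sigma>_def)
    finally show ?thesis
      using greedy_matching[OF \<epsilon> n_def[symmetric] npos t2 start[folded n_def]]
      unfolding \<beta>_def \<delta>_def n_def by blast
  qed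
  show ?thesis
    by (intro exI[of _ "\<sigma> / 2"] exI[of _ \<gamma>] exI[of _ n\<^sub>0] conjI allI impI main)
      (use \<sigma> \<gamma> n\<^sub>0 in simp_all)
qed

section \<open>Almost regular subgraphs\<close>

definition edeg :: "'b set set \<Rightarrow> 'b \<Rightarrow> nat" where
  "edeg F v = card {e\<in>F. v \<in> e}"

locale linear_k_graph =
  fixes V :: "'b set" and E :: "'b set set" and k :: nat
  assumes finV: "finite V" and EV: "\<And>e. e \<in> E \<Longrightarrow> e \<subseteq> V"
    and cardE: "\<And>e. e \<in> E \<Longrightarrow> card e = k" and k: "k \<ge> 2"
    and linear: "\<And>e f. e \<in> E \<Longrightarrow> f \<in> E \<Longrightarrow> e \<noteq> f \<Longrightarrow> card (e \<inter> f) \<le> 1"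
begin

lemma finE: "finite E"
  using finV EV by (meson PowI finite_Pow_iff finite_subset subsetI)

lemma finite_edge: "e \<in> E \<Longrightarrow> finite e"
  using EV finV finite_subset by blast

lemma subgraph: "F \<subseteq> E \<Longrightarrow> linear_k_graph V F k"
  using finV EV cardE k linear by unfold_locales blast+

lemma edge_unique:
  assumes "e \<in> E" "f \<in> E" "u \<noteq> v" "u \<in> e" "v \<in> e" "u \<in> f" "v \<in> f"
  shows "e = f"
proof (rule ccontr)
  assume "e \<noteq> f"
  then have "card (e \<inter> f) \<le> 1" using assms linear by blast
  moreover have "card {u, v} \<le> card (e \<inter> f)"
    using assms finite_edge by (intro card_mono) auto
  ultimately show False using assms by simp
qed

lemma sum_edeg:
  fixes f :: "'b \<Rightarrow> real"
  shows "(\<Sum>v\<in>V. f v * real (edeg E v)) = (\<Sum>e\<in>E. \<Sum>v\<in>e. f v)"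
  using sum_wdeg[OF finV finE, of "\<lambda>e. e" f "\<lambda>_. 1"] EV by (simp add: wdeg_def edeg_def)

lemma handshake: "(\<Sum>v\<in>V. real (edeg E v)) = real k * real (card E)"
  using sum_edeg[of "\<lambda>_. 1"] cardE by simp

text \<open>Linearity makes the union disjoint: two edges through \<open>v\<close> share nothing
  else.\<close>

lemma sum_link:
  fixes f :: "'b \<Rightarrow> real"
  shows "(\<Sum>u\<in>(\<Union>e\<in>{e\<in>E. v \<in> e}. e - {v}). f u) = (\<Sum>e\<in>{e\<in>E. v \<in> e}. \<Sum>u\<in>e - {v}. f u)"
proof (rule sum.UNION_disjoint)
  show "\<forall>e\<in>{e\<in>E. v \<in> e}. \<forall>f\<in>{e\<in>E. v \<in> e}. e \<noteq> f \<longrightarrow> (e - {v}) \<inter> (f - {v}) = {}"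
    using edge_unique[of _ _ v] by fastforce
qed (use finE finite_edge in auto)

lemma edeg_le: "edeg E v \<le> card V"
proof -
  let ?N = "\<Union>e\<in>{e\<in>E. v \<in> e}. e - {v}"
  have "real (edeg E v) = (\<Sum>e\<in>{e\<in>E. v \<in> e}. 1)" by (simp add: edeg_def)
  also have "\<dots> \<le> (\<Sum>e\<in>{e\<in>E. v \<in> e}. \<Sum>u\<in>e - {v}. 1)"
    using cardE finite_edge k by (intro sum_mono) auto
  also have "\<dots> = real (card ?N)" unfolding sum_link[symmetric] by simp
  also have "\<dots> \<le> real (card V)"
    using EV by (intro of_nat_mono card_mono finV) auto
  finally show ?thesis by simp
qed

text \<open>Let \<open>s\<close> be the sum of \<open>D - edeg F v\<close> over an edge. Deleting
  the edge changes the sum of squares by \<open>k + 2 * s\<close> and inserting it by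
  \<open>k - 2 * s\<close>. At a minimum neither is negative, which explains the slack
  \<open>k / 2\<close>.\<close>

lemma exists_local_minimum:
  fixes D :: real
  obtains F where "F \<subseteq> E"
    "\<And>e. e \<in> F \<Longrightarrow> (\<Sum>v\<in>e. D - real (edeg F v)) \<ge> - real k / 2"
    "\<And>e. e \<in> E \<Longrightarrow> e \<notin> F \<Longrightarrow> (\<Sum>v\<in>e. D - real (edeg F v)) \<le> real k / 2"
proof -
  define g where "g F = (\<Sum>v\<in>V. (D - real (edeg F v))\<^sup>2)" for F
  define F where "F = arg_min_on g (Pow E)"
  have F: "F \<subseteq> E"
    using arg_min_if_finite(1)[of "Pow E" g] finE unfolding F_def by auto
  have min: "g F \<le> g F'" if "F' \<subseteq> E" for F'
    unfolding F_def using finE that by (intro arg_min_least) auto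
  have finF: "finite F" using F finE finite_subset by blast
  \<comment> \<open>Deletion is \<open>s = 1\<close> and insertion is \<open>s = -1\<close>.\<close>
  have change: "g F' - g F = (\<Sum>v\<in>e. s * s + 2 * s * (D - real (edeg F v)))"
    if e: "e \<in> E" and F': "\<And>v. real (edeg F' v) = real (edeg F v) - s * of_bool (v \<in> e)"
    for F' e s
  proof -
    have "g F' - g F = (\<Sum>v\<in>V. if v \<in> e then s * s + 2 * s * (D - real (edeg F v)) else 0)"
      unfolding g_def sum_subtractf[symmetric]
      by (intro sum.cong refl) (auto simp: F' power2_eq_square algebra_simps)
    also have "\<dots> = (\<Sum>v\<in>{v\<in>V. v \<in> e}. s * s + 2 * s * (D - real (edeg F v)))"
      by (rule sum.inter_filter[OF finV, symmetric])
    also have "{v\<in>V. v \<in> e} = e" using EV[OF e] by auto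
    finally show ?thesis .
  qed
  show ?thesis
  proof (rule that[OF F])
    fix e assume e: "e \<in> F"
    have "real (edeg (F - {e}) v) = real (edeg F v) - 1 * of_bool (v \<in> e)" for v
    proof (cases "v \<in> e")
      case True
      have "{f\<in>F - {e}. v \<in> f} = {f\<in>F. v \<in> f} - {e}" by auto
      moreover have "card {f\<in>F. v \<in> f} > 0" using e True finF by (auto simp: card_gt_0_iff)
      ultimately show ?thesis using e True finF by (simp add: edeg_def of_nat_diff)
    next
      case False
      then have "{f\<in>F - {e}. v \<in> f} = {f\<in>F. v \<in> f}" by auto
      then show ?thesis using False by (simp add: edeg_def)
    qed
    then have "0 \<le> (\<Sum>v\<in>e. 1 * 1 + 2 * 1 * (D - real (edeg F v)))"
      using change[of e "F - {e}" 1] min[of "F - {e}"] e F by force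
    also have "\<dots> = real k + 2 * (\<Sum>v\<in>e. D - real (edeg F v))"
      unfolding sum.distrib sum_distrib_left[symmetric] using cardE e F by auto
    finally show "(\<Sum>v\<in>e. D - real (edeg F v)) \<ge> - real k / 2" by simp
  next
    fix e assume e: "e \<in> E" "e \<notin> F"
    have "real (edeg (insert e F) v) = real (edeg F v) - (-1) * of_bool (v \<in> e)" for v
    proof (cases "v \<in> e")
      case True
      then have "{f\<in>insert e F. v \<in> f} = insert e {f\<in>F. v \<in> f}" by auto
      then show ?thesis using e True finF by (simp add: edeg_def)
    next
      case False
      then have "{f\<in>insert e F. v \<in> f} = {f\<in>F. v \<in> f}" by auto
      then show ?thesis using False by (simp add: edeg_def)
    qed
    then have "0 \<le> (\<Sum>v\<in>e. (-1) * (-1) + 2 * (-1) * (D - real (edeg F v)))"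
      using change[of e "insert e F" "-1"] min[of "insert e F"] e F by force
    also have "\<dots> = real k - 2 * (\<Sum>v\<in>e. D - real (edeg F v))"
      unfolding sum.distrib sum_distrib_left[symmetric] using cardE e by simp
    finally show "(\<Sum>v\<in>e. D - real (edeg F v)) \<le> real k / 2" by simp
  qed
qed

text \<open>Writing one factor of each square as \<open>D - edeg F v\<close> gives
  \<open>\<Phi> = D * Y\<close> minus the sums of \<open>y\<close> over the chosen edges. Those sums
  are at least \<open>- k / 2\<close>, so it remains to bound the total deficit \<open>Y\<close>.
  \<open>D_small\<close> keeps the exceptional set \<open>B\<close> small, while
  \<open>D_large\<close> absorbs the errors coming from the slack \<open>k / 2\<close>.\<close>

lemma almost_regular_deviation:
  fixes D \<theta> :: real
  assumes mindeg: "\<And>v. v \<in> V \<Longrightarrow> real (card V) \<le> real k * real (edeg E v)"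
    and \<theta>: "0 < \<theta>" "\<theta> < 1" and D: "D > 0"
    and n: "real (card V) = n" "n > 0"
    and D_small: "real k * (D + n / (2 * D)) / \<theta> \<le> \<theta> * n"
    and D_large: "real k / 2 \<le> \<theta> * D" "n / 2 \<le> \<theta> * D\<^sup>2"
  shows "\<exists>F\<subseteq>E. (\<Sum>v\<in>V. (D - real (edeg F v))\<^sup>2) \<le> 4 * \<theta> * D\<^sup>2 * n"
proof -
  obtain F where F: "F \<subseteq> E"
    and inF: "\<And>e. e \<in> F \<Longrightarrow> (\<Sum>v\<in>e. D - real (edeg F v)) \<ge> - real k / 2"
    and notinF: "\<And>e. e \<in> E \<Longrightarrow> e \<notin> F \<Longrightarrow> (\<Sum>v\<in>e. D - real (edeg F v)) \<le> real k / 2"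
    by (rule exists_local_minimum[of D]) blast
  interpret F: linear_k_graph V F k by (rule subgraph[OF F])
  define y where "y v = D - real (edeg F v)" for v
  define z where "z e = max 0 (\<Sum>v\<in>e. y v)" for e
  define Y where "Y = (\<Sum>v\<in>V. y v)"
  define \<Phi> where "\<Phi> = (\<Sum>v\<in>V. (y v)\<^sup>2)"
  define Z where "Z = (\<Sum>e\<in>F. z e)"
  define Zv where "Zv v = (\<Sum>e\<in>{e\<in>F. v \<in> e}. z e)" for v
  have yD: "y v \<le> D" for v by (simp add: y_def)
  have z0: "0 \<le> z e" for e by (simp add: z_def)
  have Zv0: "0 \<le> Zv v" for v unfolding Zv_def by (intro sum_nonneg z0)
  have kF: "real k * real (card F) \<le> n * n"
  proof -
    have "real k * real (card F) \<le> (\<Sum>v\<in>V. real (card V))"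
      unfolding F.handshake[symmetric] using F.edeg_le by (intro sum_mono) auto
    then show ?thesis using n by simp
  qed
  \<comment> \<open>The positive part \<open>Z\<close> of the edge sums is kept on the left, because
    a bound on \<open>Z\<close> is what limits the size of \<open>B\<close>.\<close>
  have \<Phi>Z: "\<Phi> + Z \<le> D * Y + n * n / 2"
  proof -
    have "\<Phi> = (\<Sum>v\<in>V. D * y v - y v * real (edeg F v))"
      unfolding \<Phi>_def by (intro sum.cong refl) (simp add: y_def power2_eq_square algebra_simps)
    also have "\<dots> = D * Y - (\<Sum>e\<in>F. \<Sum>v\<in>e. y v)"
      unfolding sum_subtractf F.sum_edeg Y_def sum_distrib_left ..
    finally have "\<Phi> = D * Y - (\<Sum>e\<in>F. \<Sum>v\<in>e. y v)" .
    moreover have "(\<Sum>e\<in>F. z e - real k / 2) \<le> (\<Sum>e\<in>F. \<Sum>v\<in>e. y v)"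
    proof (rule sum_mono)
      fix e assume "e \<in> F"
      then show "z e - real k / 2 \<le> (\<Sum>v\<in>e. y v)" using inF[of e] unfolding z_def y_def by simp
    qed
    moreover have "(\<Sum>e\<in>F. z e - real k / 2) = Z - real k * real (card F) / 2"
      unfolding Z_def by (simp add: sum_subtractf mult.commute)
    ultimately show ?thesis using kF by linarith
  qed
  have \<Phi>0: "0 \<le> \<Phi>" unfolding \<Phi>_def by (intro sum_nonneg) auto
  have "Y \<le> (\<Sum>v\<in>V. D)" unfolding Y_def by (intro sum_mono yD)
  then have "D * Y \<le> D * (n * D)" using n D by (intro mult_left_mono) auto
  then have Zle: "Z \<le> D * D * n + n * n / 2" using \<Phi>Z \<Phi>0 by (simp add: mult_ac)
  define B where "B = {v\<in>V. Zv v > \<theta> * D * n}"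
  \<comment> \<open>Markov's inequality: the values \<open>Zv v\<close> sum to \<open>k * Z\<close>,
    as each edge has \<open>k\<close> vertices.\<close>
  have Bn: "real (card B) \<le> \<theta> * n"
  proof -
    have "real (card B) * (\<theta> * D * n) = (\<Sum>v\<in>B. \<theta> * D * n)" by simp
    also have "\<dots> \<le> (\<Sum>v\<in>B. Zv v)" by (intro sum_mono) (auto simp: B_def)
    also have "\<dots> \<le> (\<Sum>v\<in>V. Zv v)" using finV Zv0 by (intro sum_mono2) (auto simp: B_def)
    also have "\<dots> = (\<Sum>e\<in>F. z e * real (card (V \<inter> e)))"
      unfolding Zv_def by (rule weighted_card_inter[OF F.finE finV])
    also have "\<dots> = real k * Z"
      unfolding Z_def sum_distrib_left using F.EV F.cardE
      by (intro sum.cong refl) (auto simp: Int_absorb1)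
    also have "\<dots> \<le> real k * (D * D * n + n * n / 2)" using Zle by (intro mult_left_mono) auto
    also have "\<dots> = (real k * (D + n / (2 * D)) / \<theta>) * (\<theta> * D * n)"
      using \<theta> D n(2) by (simp add: field_simps)
    also have "\<dots> \<le> \<theta> * n * (\<theta> * D * n)"
      using D_small \<theta> D n(2) by (intro mult_right_mono) auto
    finally show ?thesis using \<theta> D n(2) by simp
  qed
  have "V - B \<noteq> {}"
  proof
    assume "V - B = {}"
    then have "n \<le> real (card B)" using n card_mono[of B V] finV by (auto simp: B_def)
    also have "\<dots> \<le> \<theta> * n" by (rule Bn)
    also have "\<dots> < 1 * n" using \<theta> n by (intro mult_strict_right_mono) auto
    finally show False by simp
  qed
  \<comment> \<open>Double counting around a vertex of maximal deficit bounds the total deficit; the exceptional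
    set \<open>B\<close> is avoided because there the excess of \<open>y\<close> over the incident edges is not controlled.\<close>
  define v where "v = arg_min_on (\<lambda>u. - y u) (V - B)"
  have v: "v \<in> V - B"
    unfolding v_def using \<open>V - B \<noteq> {}\<close> finV by (intro arg_min_if_finite(1)) auto
  have max: "y u \<le> y v" if "u \<in> V - B" for u
    using arg_min_least[of "V - B" u "\<lambda>u. - y u"] that finV unfolding v_def by auto
  have BD: "real (card B) * D \<le> \<theta> * D * n"
    using mult_right_mono[OF Bn less_imp_le[OF D]] by (simp add: mult_ac)
  have finB: "finite B" using finV by (simp add: B_def)
  have "Y \<le> 3 * \<theta> * D * n"
  proof (cases "y v \<ge> 0")
    case False
    have "Y = (\<Sum>u\<in>B. y u) + (\<Sum>u\<in>V - B. y u)"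
      unfolding Y_def using finV by (subst add.commute, intro sum.subset_diff) (auto simp: B_def)
    also have "\<dots> \<le> (\<Sum>u\<in>B. D) + (\<Sum>u\<in>V - B. 0)"
      using max False by (intro add_mono sum_mono yD) force
    also have "\<dots> \<le> \<theta> * D * n" using BD by simp
    also have "\<dots> \<le> 3 * \<theta> * D * n" using \<theta> D n by simp
    finally show ?thesis .
  next
    case True
    define a where "a = y v"
    define Ev where "Ev = {e\<in>E. v \<in> e}"
    define N where "N = (\<Union>e\<in>Ev. e - {v})"
    have N: "N \<subseteq> V" "v \<notin> N" unfolding N_def Ev_def using EV by auto
    have cardEv: "real (card Ev) = real (edeg E v)" by (simp add: Ev_def edeg_def)
    have "Y - n * a = (\<Sum>u\<in>V. y u - a)" using n(1) by (simp add: Y_def sum_subtractf)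
    also have "\<dots> = (\<Sum>u\<in>N. y u - a) + (\<Sum>u\<in>V - N. y u - a)"
      using N finV by (subst add.commute, intro sum.subset_diff)
    also have "(\<Sum>u\<in>N. y u - a) = (\<Sum>e\<in>Ev. \<Sum>u\<in>e - {v}. y u - a)"
      unfolding N_def Ev_def by (rule sum_link)
    also have "\<dots> \<le> (\<Sum>e\<in>Ev. (if e \<in> F then z e else 0) + real k / 2 - real k * a)"
    proof (rule sum_mono)
      fix e assume e: "e \<in> Ev"
      \<comment> \<open>The term at \<open>v\<close> is zero because \<open>a = y v\<close>, so the
        sum extends to the whole edge, where local minimality applies.\<close>
      have "(\<Sum>u\<in>e - {v}. y u - a) = (\<Sum>u\<in>e. y u - a)"
        using e finite_edge by (simp add: Ev_def sum_diff1 a_def)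
      also have "\<dots> = (\<Sum>u\<in>e. y u) - real k * a"
        using e cardE by (simp add: sum_subtractf Ev_def)
      also have "(\<Sum>u\<in>e. y u) \<le> (if e \<in> F then z e else 0) + real k / 2"
        using e notinF[of e] unfolding z_def y_def Ev_def by auto
      finally show "(\<Sum>u\<in>e - {v}. y u - a) \<le> (if e \<in> F then z e else 0) + real k / 2 - real k * a"
        by simp
    qed
    also have "\<dots> = (\<Sum>e\<in>Ev. if e \<in> F then z e else 0) + real (edeg E v) * (real k / 2 - real k * a)"
      by (simp add: sum.distrib sum_subtractf cardEv algebra_simps)
    also have "(\<Sum>e\<in>Ev. if e \<in> F then z e else 0) = Zv v"
    proof -
      have eq: "{e\<in>Ev. e \<in> F} = {e\<in>F. v \<in> e}" using F by (auto simp: Ev_def)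
      show ?thesis unfolding Zv_def eq[symmetric]
        using finE by (intro sum.inter_filter[symmetric]) (auto simp: Ev_def)
    qed
    also have "\<dots> \<le> \<theta> * D * n" using v by (auto simp: B_def)
    also have "(\<Sum>u\<in>V - N. y u - a) \<le> (\<Sum>u\<in>V - N. if u \<in> B then D else 0)"
    proof (rule sum_mono)
      fix u assume "u \<in> V - N"
      then show "y u - a \<le> (if u \<in> B then D else 0)"
        using max[of u] True yD[of u] unfolding a_def by (auto split: if_splits)
    qed
    also have "\<dots> \<le> (\<Sum>u\<in>V. if u \<in> B then D else 0)"
      using finV D by (intro sum_mono2) auto
    also have "\<dots> = real (card B) * D"
      using finV by (simp add: sum.inter_filter[symmetric] B_def conj_commute cong: conj_cong)
    finally have "Y - n * a \<le> \<theta> * D * n + real (edeg E v) * (real k / 2 - real k * a) + real (card B) * D"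
      by simp
    \<comment> \<open>The minimum degree enters here: \<open>k * edeg E v \<ge> n\<close> and
      \<open>a \<ge> 0\<close> produce a term \<open>- n * a\<close>, which cancels the one
      subtracted from \<open>Y\<close>.\<close>
    moreover have "real (edeg E v) * (real k / 2 - real k * a) \<le> \<theta> * D * n - n * a"
    proof -
      have "real (edeg E v) \<le> n" using edeg_le[of v] n by simp
      then have "real (edeg E v) * (real k / 2) \<le> n * (\<theta> * D)"
        using D_large(1) n \<theta> by (intro mult_mono) auto
      moreover have "n * a \<le> real k * real (edeg E v) * a"
        using mindeg[of v] v True n unfolding a_def by (intro mult_right_mono) auto
      ultimately show ?thesis by (simp add: algebra_simps)
    qed
    ultimately show ?thesis using BD by linarith
  qed
  then have "D * Y \<le> D * (3 * \<theta> * D * n)" using D by (intro mult_left_mono) auto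
  moreover have "n / 2 * n \<le> \<theta> * D\<^sup>2 * n" using D_large(2) n(2) by (intro mult_right_mono) auto
  moreover have "0 \<le> Z" unfolding Z_def by (intro sum_nonneg z0)
  ultimately have "\<Phi> \<le> 4 * \<theta> * D\<^sup>2 * n" using \<Phi>Z by (simp add: power2_eq_square mult_ac)
  then show ?thesis using F unfolding \<Phi>_def y_def by blast
qed

text \<open>Normalising the embedding weights later needs a bound on all degrees, not on most of
  them. Every vertex of too large degree discards its surplus edges. Their number is at most the sum
  of the absolute deviations, and each discarded edge lowers the degree sum by
  \<open>k\<close>.\<close>

lemma truncate_degrees:
  fixes D :: nat
  assumes "F \<subseteq> E"
  obtains F' where "F' \<subseteq> F" "\<And>v. v \<in> V \<Longrightarrow> edeg F' v \<le> D"
    "(\<Sum>v\<in>V. real D - real (edeg F' v)) \<le> real (k + 1) * (\<Sum>v\<in>V. \<bar>real D - real (edeg F v)\<bar>)"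
proof -
  interpret F: linear_k_graph V F k by (rule subgraph[OF assms])
  have "\<exists>R\<subseteq>{e\<in>F. v \<in> e}. card R = edeg F v - D" for v
    by (rule ex_card) (simp add: edeg_def)
  then obtain R where R: "\<And>v. R v \<subseteq> {e\<in>F. v \<in> e}" "\<And>v. card (R v) = edeg F v - D" by metis
  define U where "U = (\<Union>v\<in>V. R v)"
  have UF: "U \<subseteq> F" using R(1) by (auto simp: U_def)
  interpret F': linear_k_graph V "F - U" k by (rule subgraph) (use assms in auto)
  have fin: "finite {e\<in>F. v \<in> e}" for v using F.finE by simp
  have cardU: "real (card U) \<le> (\<Sum>v\<in>V. \<bar>real D - real (edeg F v)\<bar>)"
  proof -
    have "card U \<le> (\<Sum>v\<in>V. card (R v))" unfolding U_def by (rule card_UN_le[OF finV])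
    then have "real (card U) \<le> (\<Sum>v\<in>V. real (card (R v)))" by (simp flip: of_nat_sum)
    also have "\<dots> \<le> (\<Sum>v\<in>V. \<bar>real D - real (edeg F v)\<bar>)"
      unfolding R(2) by (intro sum_mono) auto
    finally show ?thesis .
  qed
  show ?thesis
  proof (rule that[of "F - U"])
    fix v assume v: "v \<in> V"
    have "edeg (F - U) v \<le> card ({e\<in>F. v \<in> e} - R v)"
      unfolding edeg_def using v fin by (intro card_mono) (auto simp: U_def)
    also have "\<dots> = edeg F v - (edeg F v - D)"
      using R fin finite_subset[OF R(1) fin] by (simp add: card_Diff_subset edeg_def)
    also have "\<dots> \<le> D" by simp
    finally show "edeg (F - U) v \<le> D" .
  next
    have "(\<Sum>v\<in>V. real D - real (edeg (F - U) v)) = real D * real (card V) - real k * real (card (F - U))"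
      unfolding sum_subtractf F'.handshake by simp
    also have "real (card (F - U)) = real (card F) - real (card U)"
      using UF F.finE by (simp add: card_Diff_subset finite_subset of_nat_diff card_mono)
    also have "real D * real (card V) - real k * (real (card F) - real (card U))
        = (\<Sum>v\<in>V. real D - real (edeg F v)) + real k * real (card U)"
      unfolding sum_subtractf F.handshake by (simp add: algebra_simps)
    also have "\<dots> \<le> (\<Sum>v\<in>V. \<bar>real D - real (edeg F v)\<bar>) + real k * (\<Sum>v\<in>V. \<bar>real D - real (edeg F v)\<bar>)"
      using cardU by (intro add_mono sum_mono mult_left_mono) auto
    finally show "(\<Sum>v\<in>V. real D - real (edeg (F - U) v))
      \<le> real (k + 1) * (\<Sum>v\<in>V. \<bar>real D - real (edeg F v)\<bar>)" by (simp add: algebra_simps)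
  qed auto
qed

end

theorem almost_regular_subgraph:
  fixes \<eta> :: real and k :: nat
  assumes "\<eta> > 0" "k \<ge> 2"
  shows "\<exists>\<delta> n\<^sub>0. \<delta> > 0 \<and> n\<^sub>0 > 0 \<and> (\<forall>(V :: 'b set) E. linear_k_graph V E k \<longrightarrow> real (card V) \<ge> n\<^sub>0 \<longrightarrow>
    (\<forall>v\<in>V. real (card V) \<le> real k * real (edeg E v)) \<longrightarrow>
    (\<exists>F\<subseteq>E. \<exists>D :: nat. real D \<ge> \<delta> * real (card V) \<and> (\<forall>v\<in>V. edeg F v \<le> D) \<and>
       (\<Sum>v\<in>V. real D - real (edeg F v)) \<le> \<eta> * real D * real (card V)))"
proof -
  \<comment> \<open>Cauchy-Schwarz turns the bound \<open>4 * \<theta> * D^2 * n\<close> on the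
    squares into \<open>2 * s * D * n\<close> with \<open>\<theta> = s^2\<close>. The choice of
    \<open>s\<close> absorbs the factor \<open>k + 1\<close> from \<open>truncate_degrees\<close>
    into \<open>\<eta>\<close>.\<close>
  define s where "s = min (\<eta> / (2 * (real k + 1))) (1 / 2)"
  define \<theta> where "\<theta> = s\<^sup>2"
  have s: "0 < s" "s \<le> 1 / 2" "s \<le> \<eta> / (2 * (real k + 1))"
    using assms unfolding s_def by (simp_all only: min_less_iff_conj min.cobounded1 min.cobounded2) auto
  have "s * s \<le> s * (1 / 2)" using s by (intro mult_left_mono) auto
  then have "s * s < 1" using s(2) by linarith
  then have \<theta>: "0 < \<theta>" "\<theta> < 1" using s(1) by (auto simp: \<theta>_def power2_eq_square)
  \<comment> \<open>Makes \<open>2 * k * \<delta> / \<theta>\<close> equal to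
    \<open>\<theta> / 2\<close>, which accounts for half of \<open>D_small\<close> when
    \<open>D \<le> 2 * \<delta> * n\<close>.\<close>
  define \<delta> where "\<delta> = \<theta>\<^sup>2 / (4 * real k)"
  have \<delta>: "\<delta> > 0" using \<theta> assms by (simp add: \<delta>_def)
  \<comment> \<open>In this order the entries give \<open>D \<le> 2 * \<delta> * n\<close> despite
    rounding up, the other half of \<open>D_small\<close>, and the two conditions
    \<open>D_large\<close>.\<close>
  define n\<^sub>0 where "n\<^sub>0 = Max {1 / \<delta>, real k / (\<delta> * \<theta>\<^sup>2), real k / (2 * \<theta> * \<delta>), 1 / (2 * \<theta> * \<delta>\<^sup>2)}"
  have n\<^sub>0: "1 / \<delta> \<le> n\<^sub>0" "real k / (\<delta> * \<theta>\<^sup>2) \<le> n\<^sub>0" "real k / (2 * \<theta> * \<delta>) \<le> n\<^sub>0" "1 / (2 * \<theta> * \<delta>\<^sup>2) \<le> n\<^sub>0"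
    unfolding n\<^sub>0_def by (intro Max_ge; simp)+
  have n\<^sub>0pos: "n\<^sub>0 > 0" using n\<^sub>0(1) \<delta> by (smt (verit) divide_pos_pos)
  have "\<exists>F\<subseteq>E. \<exists>D :: nat. real D \<ge> \<delta> * real (card V) \<and> (\<forall>v\<in>V. edeg F v \<le> D) \<and>
       (\<Sum>v\<in>V. real D - real (edeg F v)) \<le> \<eta> * real D * real (card V)"
    if lin: "linear_k_graph V E k" and nn: "real (card V) \<ge> n\<^sub>0"
      and mindeg: "\<forall>v\<in>V. real (card V) \<le> real k * real (edeg E v)" for V :: "'b set" and E
  proof -
    interpret linear_k_graph V E k by (rule lin)
    define n where "n = real (card V)"
    have n: "n > 0" using nn n\<^sub>0pos unfolding n_def by linarith
    have nn: "1 / \<delta> \<le> n" "real k / (\<delta> * \<theta>\<^sup>2) \<le> n" "real k / (2 * \<theta> * \<delta>) \<le> n" "1 / (2 * \<theta> * \<delta>\<^sup>2) \<le> n"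
      using nn n\<^sub>0 unfolding n_def by linarith+
    define D where "D = nat \<lceil>\<delta> * n\<rceil>"
    have D1: "\<delta> * n \<le> real D" unfolding D_def by (rule real_nat_ceiling_ge)
    have dn: "0 < \<delta> * n" using \<delta> n by simp
    have Dpos: "0 < real D" using D1 dn by linarith
    have "real D \<le> \<delta> * n + 1" using dn unfolding D_def by linarith
    also have "1 \<le> \<delta> * n" using nn(1) \<delta> by (simp add: field_simps)
    finally have D2: "real D \<le> 2 * (\<delta> * n)" by simp
    have "real k * (real D + n / (2 * real D)) / \<theta> \<le> real k * (2 * (\<delta> * n) + n / (2 * (\<delta> * n))) / \<theta>"
      using D1 D2 dn n \<theta> by (intro divide_right_mono mult_left_mono add_mono divide_left_mono) auto
    also have "\<dots> = 2 * real k * \<delta> / \<theta> * n + real k / (2 * \<delta> * \<theta>)"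
      using n \<delta> \<theta> by (simp add: field_simps)
    also have "2 * real k * \<delta> / \<theta> * n = \<theta> / 2 * n"
      using \<theta> assms by (simp add: \<delta>_def power2_eq_square)
    also have "real k / (2 * \<delta> * \<theta>) \<le> \<theta> / 2 * n"
      using nn(2) \<delta> \<theta> by (simp add: field_simps power2_eq_square)
    finally have h1: "real k * (real D + n / (2 * real D)) / \<theta> \<le> \<theta> * n" by simp
    have "real k / 2 \<le> \<theta> * (\<delta> * n)" using nn(3) \<delta> \<theta> by (simp add: field_simps)
    also have "\<dots> \<le> \<theta> * real D" using D1 \<theta> by simp
    finally have h2: "real k / 2 \<le> \<theta> * real D" .
    have "1 \<le> 2 * \<theta> * \<delta>\<^sup>2 * n" using nn(4) \<delta> \<theta> by (simp add: field_simps)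
    then have "n * 1 \<le> n * (2 * \<theta> * \<delta>\<^sup>2 * n)" using n by (intro mult_left_mono) auto
    then have "n / 2 \<le> \<theta> * (\<delta> * n)\<^sup>2" by (simp add: power2_eq_square algebra_simps)
    also have "\<dots> \<le> \<theta> * (real D)\<^sup>2" using D1 dn \<theta> by (intro mult_left_mono power_mono) auto
    finally have h3: "n / 2 \<le> \<theta> * (real D)\<^sup>2" .
    obtain F where F: "F \<subseteq> E"
      and dev: "(\<Sum>v\<in>V. (real D - real (edeg F v))\<^sup>2) \<le> 4 * \<theta> * (real D)\<^sup>2 * n"
      using almost_regular_deviation[OF _ \<theta> Dpos n_def[symmetric] n h1 h2 h3] mindeg by blast
    obtain F' where F': "F' \<subseteq> F" "\<And>v. v \<in> V \<Longrightarrow> edeg F' v \<le> D"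
      "(\<Sum>v\<in>V. real D - real (edeg F' v)) \<le> real (k + 1) * (\<Sum>v\<in>V. \<bar>real D - real (edeg F v)\<bar>)"
      by (rule truncate_degrees[OF F, where D = D]) (rule that; assumption)
    have "(\<Sum>v\<in>V. \<bar>real D - real (edeg F v)\<bar>)\<^sup>2 \<le> n * (\<Sum>v\<in>V. (real D - real (edeg F v))\<^sup>2)"
      using sum_squared_le_sum_of_squares[of "\<lambda>v. \<bar>real D - real (edeg F v)\<bar>" V] finV
      unfolding n_def by (simp add: mult.commute)
    also have "\<dots> \<le> n * (4 * \<theta> * (real D)\<^sup>2 * n)" using dev n by (intro mult_left_mono) auto
    also have "\<dots> = (2 * s * real D * n)\<^sup>2" by (simp add: \<theta>_def power2_eq_square)
    finally have "(\<Sum>v\<in>V. \<bar>real D - real (edeg F v)\<bar>) \<le> 2 * s * real D * n"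
      by (rule power2_le_imp_le) (use s n in auto)
    then have "real (k + 1) * (\<Sum>v\<in>V. \<bar>real D - real (edeg F v)\<bar>) \<le> real (k + 1) * (2 * s * real D * n)"
      by (intro mult_left_mono) auto
    also have "\<dots> = (2 * (real k + 1) * s) * (real D * n)" by (simp add: algebra_simps)
    also have "\<dots> \<le> \<eta> * (real D * n)"
      using s(3) n by (intro mult_right_mono) (auto simp: field_simps)
    finally show ?thesis
      using F F' D1 unfolding n_def by (intro exI[of _ F'] conjI exI[of _ D]) auto
  qed
  then show ?thesis using \<delta> n\<^sub>0pos by blast
qed

section \<open>Hypertrees\<close>

inductive htree :: "nat \<Rightarrow> 'a set \<Rightarrow> 'a set set \<Rightarrow> bool" for k where
  vertex: "htree k {x} {}"
| leaf_edge: "htree k V E \<Longrightarrow> finite e \<Longrightarrow> card e = k \<Longrightarrow> e \<inter> V = {z} \<Longrightarrow> htree k (V \<union> e) (insert e E)"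

lemma htree_finite: "htree k V E \<Longrightarrow> finite V"
  by (induction rule: htree.induct) auto

lemma htree_edges:
  assumes "htree k V E"
  shows "finite E" and "e \<in> E \<Longrightarrow> e \<subseteq> V" and "e \<in> E \<Longrightarrow> card e = k"
  using assms by (induction arbitrary: e rule: htree.induct) auto

text \<open>One labelled form for all lengths, including length one, with \<open>u\<close> and
  \<open>v\<close> as the outer joints. The path is only required to lie inside
  \<open>(V, E)\<close>, so it survives the growth of the tree.\<close>

definition path_between ::
  "nat \<Rightarrow> 'a set \<Rightarrow> 'a set set \<Rightarrow> nat \<Rightarrow> (nat \<Rightarrow> 'a) \<Rightarrow> (nat \<Rightarrow> nat \<Rightarrow> 'a) \<Rightarrow> 'a \<Rightarrow> 'a \<Rightarrow> bool" where
  "path_between k V E l x y u v \<longleftrightarrow> l \<ge> 1 \<and> inj_on x {1..l + 1} \<and>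
     inj_on (\<lambda>(i, j). y i j) ({1..l} \<times> {1..k - 2}) \<and>
     x ` {1..l + 1} \<inter> (\<lambda>(i, j). y i j) ` ({1..l} \<times> {1..k - 2}) = {} \<and>
     x ` {1..l + 1} \<union> (\<lambda>(i, j). y i j) ` ({1..l} \<times> {1..k - 2}) \<subseteq> V \<and>
     path_edge k x y ` {1..l} \<subseteq> E \<and> x 1 = u \<and> x (l + 1) = v"

definition connected_in :: "nat \<Rightarrow> 'a set \<Rightarrow> 'a set set \<Rightarrow> 'a \<Rightarrow> 'a \<Rightarrow> bool" where
  "connected_in k V E u v \<longleftrightarrow> (\<exists>l x y. path_between k V E l x y u v)"

lemma path_between_mono:
  assumes "path_between k V E l x y u v" "V \<subseteq> V'" "E \<subseteq> E'"
  shows "path_between k V' E' l x y u v"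
proof -
  have "x ` {1..l + 1} \<union> (\<lambda>(i, j). y i j) ` ({1..l} \<times> {1..k - 2}) \<subseteq> V'"
    using assms(1,2) unfolding path_between_def by (meson subset_trans)
  moreover have "path_edge k x y ` {1..l} \<subseteq> E'"
    using assms(1,3) unfolding path_between_def by (meson subset_trans)
  ultimately show ?thesis using assms(1) unfolding path_between_def by simp
qed

lemma connected_in_mono:
  "connected_in k V E u v \<Longrightarrow> V \<subseteq> V' \<Longrightarrow> E \<subseteq> E' \<Longrightarrow> connected_in k V' E' u v"
  unfolding connected_in_def by (meson path_between_mono)

lemma connected_in_sym:
  assumes "connected_in k V E u v"
  shows "connected_in k V E v u"
proof -
  obtain l x y where p: "path_between k V E l x y u v"
    using assms by (auto simp: connected_in_def)
  \<comment> \<open>Reversal of the path. The joints run up to \<open>l + 1\<close> and the edges up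
    to \<open>l\<close>, hence the two offsets.\<close>
  define x' where "x' i = x (l + 2 - i)" for i
  define y' where "y' i = y (l + 1 - i)" for i
  have flip: "(\<lambda>i. m - i) ` {1..m - 1} = {1..m - 1}" for m :: nat
  proof (intro equalityI subsetI)
    fix i assume "i \<in> {1..m - 1}"
    then show "i \<in> (\<lambda>i. m - i) ` {1..m - 1}" by (intro image_eqI[of _ _ "m - i"]) auto
  qed auto
  have rx: "(\<lambda>i. l + 2 - i) ` {1..l + 1} = {1..l + 1}" using flip[of "l + 2"] by simp
  have ry: "(\<lambda>i. l + 1 - i) ` {1..l} = {1..l}" using flip[of "l + 1"] by simp
  have ix: "x' ` {1..l + 1} = x ` {1..l + 1}"
    using rx unfolding x'_def by (metis image_image)
  have iy: "(\<lambda>(i, j). y' i j) ` ({1..l} \<times> {1..k - 2}) = (\<lambda>(i, j). y i j) ` ({1..l} \<times> {1..k - 2})"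
  proof -
    have "({1..l} \<times> {1..k - 2}) = (\<lambda>(i, j). (l + 1 - i, j)) ` ({1..l} \<times> {1..k - 2})"
      unfolding image_paired_Times using ry by simp
    then have "(\<lambda>(i, j). y i j) ` ({1..l} \<times> {1..k - 2})
        = (\<lambda>(i, j). y i j) ` (\<lambda>(i, j). (l + 1 - i, j)) ` ({1..l} \<times> {1..k - 2})" by simp
    also have "\<dots> = (\<lambda>(i, j). y' i j) ` ({1..l} \<times> {1..k - 2})"
      unfolding image_image y'_def by (intro image_cong) auto
    finally show ?thesis by simp
  qed
  have injx: "inj_on x' {1..l + 1}"
  proof (rule inj_onI)
    fix i j assume ij: "i \<in> {1..l + 1}" "j \<in> {1..l + 1}" "x' i = x' j"
    have "inj_on x {1..l + 1}" using p by (simp add: path_between_def)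
    moreover have "l + 2 - i \<in> {1..l + 1}" "l + 2 - j \<in> {1..l + 1}" using ij by auto
    ultimately have "l + 2 - i = l + 2 - j" using ij(3) unfolding x'_def inj_on_def by blast
    then show "i = j" using ij by auto
  qed
  have injy: "inj_on (\<lambda>(i, j). y' i j) ({1..l} \<times> {1..k - 2})"
  proof (rule inj_onI, clarify)
    fix i j i' j' assume ij: "i \<in> {1..l}" "j \<in> {1..k - 2}" "i' \<in> {1..l}" "j' \<in> {1..k - 2}" "y' i j = y' i' j'"
    have inj: "inj_on (\<lambda>(i, j). y i j) ({1..l} \<times> {1..k - 2})" using p by (simp add: path_between_def)
    have "(\<lambda>(i, j). y i j) (l + 1 - i, j) = (\<lambda>(i, j). y i j) (l + 1 - i', j')"
      using ij(5) by (simp add: y'_def)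
    from inj_onD[OF inj this] have "(l + 1 - i, j) = (l + 1 - i', j')" using ij by force
    then show "i = i' \<and> j = j'" using ij by auto
  qed
  have "path_edge k x' y' i = path_edge k x y (l + 1 - i)" if "i \<in> {1..l}" for i
    using that by (auto simp: path_edge_def x'_def y'_def Suc_diff_le)
  then have "path_edge k x' y' ` {1..l} = path_edge k x y ` (\<lambda>i. l + 1 - i) ` {1..l}"
    unfolding image_image by (intro image_cong) auto
  then have "path_edge k x' y' ` {1..l} = path_edge k x y ` {1..l}" unfolding ry .
  then have "path_between k V E l x' y' v u"
    using p injx injy unfolding path_between_def ix iy by (auto simp: x'_def)
  then show ?thesis by (auto simp: connected_in_def)
qed

lemma enumerate_edge_interior:
  assumes "finite e" "card e = k" "u \<in> e" "v \<in> e" "u \<noteq> v"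
  obtains h where "bij_betw h {1..k - 2} (e - {u, v})"
proof -
  have "card (e - {u, v}) = k - 2" using assms by (simp add: card_Diff_subset)
  then show ?thesis using ex_bij_betw_nat_finite_1[of "e - {u, v}"] assms that by auto
qed

lemma connected_in_edge:
  assumes e: "finite e" "card e = k" "u \<in> e" "v \<in> e" "u \<noteq> v" "e \<in> E" "e \<subseteq> V"
  shows "connected_in k V E u v"
proof -
  obtain h where h: "bij_betw h {1..k - 2} (e - {u, v})" by (rule enumerate_edge_interior[OF e(1-5)])
  define x where "x i = (if i = 1 then u else v)" for i :: nat
  have "inj_on h {1..k - 2}" "h ` {1..k - 2} = e - {u, v}" using h by (auto simp: bij_betw_def)
  moreover have "{1..1 + 1} = {1, 2::nat}" by auto
  moreover have "inj_on (\<lambda>(i, j). h j) ({1..1::nat} \<times> {1..k - 2})"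
    using h by (auto simp: inj_on_def bij_betw_def)
  moreover have "(\<lambda>(i, j). h j) ` ({1..1::nat} \<times> {1..k - 2}) = e - {u, v}"
  proof -
    have "{1..1::nat} \<times> {1..k - 2} = (\<lambda>j. (1, j)) ` {1..k - 2}" by auto
    then show ?thesis using h by (simp add: image_image bij_betw_def)
  qed
  moreover have "path_edge k x (\<lambda>_. h) 1 = e"
    using e h by (auto simp: path_edge_def x_def bij_betw_def)
  ultimately have "path_between k V E 1 x (\<lambda>_. h) u v"
    using e unfolding path_between_def by (auto simp: x_def inj_on_def)
  then show ?thesis by (auto simp: connected_in_def)
qed

text \<open>Append \<open>e\<close> as edge number \<open>l + 1\<close> with \<open>v\<close> as
  joint number \<open>l + 2\<close>. The vertices of \<open>e\<close> other than \<open>z\<close>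
  lie outside \<open>V\<close>, so they differ from all earlier labels.\<close>

lemma connected_in_extend:
  assumes con: "connected_in k V E u z"
    and e: "finite e" "card e = k" "e \<inter> V = {z}" "v \<in> e" "v \<noteq> z"
  shows "connected_in k (V \<union> e) (insert e E) u v"
proof -
  obtain l x y where p: "path_between k V E l x y u z"
    using con by (auto simp: connected_in_def)
  have "z \<in> e" using e by auto
  obtain h where h: "bij_betw h {1..k - 2} (e - {z, v})"
    by (rule enumerate_edge_interior[OF e(1,2) \<open>z \<in> e\<close> e(4)]) (use e in auto)
  have vV: "v \<notin> V" using e by auto
  have hV: "h ` {1..k - 2} \<inter> V = {}" "v \<notin> h ` {1..k - 2}" using h e by (auto simp: bij_betw_def)
  define x' where "x' = x(l + 2 := v)"
  define y' where "y' = y(l + 1 := h)"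
  have l: "l \<ge> 1" using p by (simp add: path_between_def)
  have sx: "{1..(l + 1) + 1} = insert (l + 2) {1..l + 1}" by auto
  have sy: "{1..l + 1} \<times> {1..k - 2} = ({1..l} \<times> {1..k - 2}) \<union> ({l + 1} \<times> {1..k - 2})" by auto
  have x'x: "x' ` {1..l + 1} = x ` {1..l + 1}" by (intro image_cong) (auto simp: x'_def)
  have ix: "x' ` {1..(l + 1) + 1} = insert v (x ` {1..l + 1})"
    unfolding sx image_insert x'x by (simp add: x'_def)
  have y'y: "(\<lambda>(i, j). y' i j) ` ({1..l} \<times> {1..k - 2}) = (\<lambda>(i, j). y i j) ` ({1..l} \<times> {1..k - 2})"
    by (intro image_cong) (auto simp: y'_def)
  have y'h: "(\<lambda>(i, j). y' i j) ` ({l + 1} \<times> {1..k - 2}) = h ` {1..k - 2}"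
  proof -
    have "{l + 1} \<times> {1..k - 2} = (\<lambda>j. (l + 1, j)) ` {1..k - 2}" by auto
    then show ?thesis by (simp add: image_image y'_def)
  qed
  have iy: "(\<lambda>(i, j). y' i j) ` ({1..l + 1} \<times> {1..k - 2})
      = (\<lambda>(i, j). y i j) ` ({1..l} \<times> {1..k - 2}) \<union> h ` {1..k - 2}"
    unfolding sy image_Un y'y y'h ..
  have xV: "x ` {1..l + 1} \<subseteq> V" "(\<lambda>(i, j). y i j) ` ({1..l} \<times> {1..k - 2}) \<subseteq> V"
    using p by (auto simp: path_between_def)
  have injx: "inj_on x' {1..(l + 1) + 1}"
  proof -
    have "inj_on x' {1..l + 1} \<longleftrightarrow> inj_on x {1..l + 1}"
      by (rule inj_on_cong) (auto simp: x'_def)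
    then have "inj_on x' {1..l + 1}" using p by (simp add: path_between_def)
    moreover have "x' (l + 2) \<notin> x' ` ({1..l + 1} - {l + 2})"
      using vV xV x'x by (auto simp: x'_def)
    ultimately show ?thesis unfolding sx inj_on_insert by blast
  qed
  have injy: "inj_on (\<lambda>(i, j). y' i j) ({1..l + 1} \<times> {1..k - 2})"
  proof -
    have a: "inj_on (\<lambda>(i, j). y' i j) ({1..l} \<times> {1..k - 2})"
    proof -
      have "inj_on (\<lambda>(i, j). y' i j) ({1..l} \<times> {1..k - 2})
          \<longleftrightarrow> inj_on (\<lambda>(i, j). y i j) ({1..l} \<times> {1..k - 2})"
        by (rule inj_on_cong) (auto simp: y'_def)
      then show ?thesis using p by (simp add: path_between_def)
    qed
    have b: "inj_on (\<lambda>(i, j). y' i j) ({l + 1} \<times> {1..k - 2})"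
      using h by (auto simp: inj_on_def y'_def bij_betw_def)
    have "(\<lambda>(i, j). y' i j) ` ({1..l} \<times> {1..k - 2}) \<inter> (\<lambda>(i, j). y' i j) ` ({l + 1} \<times> {1..k - 2}) = {}"
      unfolding y'y y'h using hV xV by blast
    then show ?thesis unfolding sy inj_on_Un using a b by blast
  qed
  have "x ` {1..l + 1} \<inter> (\<lambda>(i, j). y i j) ` ({1..l} \<times> {1..k - 2}) = {}"
    using p by (simp add: path_between_def)
  then have disj: "x' ` {1..(l + 1) + 1} \<inter> (\<lambda>(i, j). y' i j) ` ({1..l + 1} \<times> {1..k - 2}) = {}"
    using xV hV vV unfolding ix iy by blast
  have sub: "x' ` {1..(l + 1) + 1} \<union> (\<lambda>(i, j). y' i j) ` ({1..l + 1} \<times> {1..k - 2}) \<subseteq> V \<union> e"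
    using xV h e unfolding ix iy by (auto simp: bij_betw_def)
  have "path_edge k x' y' i = path_edge k x y i" if "i \<in> {1..l}" for i
    using that by (auto simp: path_edge_def x'_def y'_def)
  moreover have "path_edge k x' y' (l + 1) = e"
    using p h e \<open>z \<in> e\<close> by (auto simp: path_edge_def x'_def y'_def bij_betw_def path_between_def)
  ultimately have "path_edge k x' y' i \<in> insert e E" if "i \<in> {1..l + 1}" for i
    using that p by (cases "i = l + 1") (auto simp: path_between_def image_subset_iff)
  then have "path_between k (V \<union> e) (insert e E) (l + 1) x' y' u v"
    unfolding path_between_def using injx injy disj sub p l
    by (intro conjI image_subsetI) (simp_all add: x'_def path_between_def)
  then show ?thesis by (auto simp: connected_in_def)
qed

lemma htree_connected:
  assumes "htree k V E" "u \<in> V" "v \<in> V" "u \<noteq> v"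
  shows "connected_in k V E u v"
  using assms
proof (induction arbitrary: u v rule: htree.induct)
  case (vertex x)
  then show ?case by simp
next
  case (leaf_edge V E e z)
  have ext: "connected_in k (V \<union> e) (insert e E) a b" if "a \<in> V" "b \<in> e" "b \<notin> V" for a b
  proof (cases "a = z")
    case True
    then show ?thesis using leaf_edge that by (intro connected_in_edge[of e]) auto
  next
    case False
    then have "connected_in k V E a z" using leaf_edge that by blast
    then show ?thesis using leaf_edge that by (intro connected_in_extend) auto
  qed
  show ?case
  proof (cases "u \<in> V \<and> v \<in> V")
    case True
    then have "connected_in k V E u v" using leaf_edge by blast
    then show ?thesis by (rule connected_in_mono) auto
  next
    case False
    then consider "u \<in> V" "v \<in> e" "v \<notin> V" | "v \<in> V" "u \<in> e" "u \<notin> V" | "u \<in> e" "v \<in> e"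
      using leaf_edge.prems by blast
    then show ?thesis
    proof cases
      case 1 then show ?thesis by (rule ext)
    next
      case 2 then show ?thesis by (intro connected_in_sym[OF ext])
    next
      case 3 then show ?thesis using leaf_edge by (intro connected_in_edge[of e]) auto
    qed
  qed
qed

text \<open>Returns to the two separate cases of \<open>linear_uv_path\<close>. That
  \<open>P\<close> has an edge, and only edges from \<open>E\<close>, will distinguish it from a
  path formed by one edge outside \<open>E\<close>.\<close>

lemma connected_in_linear_uv_path:
  assumes con: "connected_in k V E u v" and uv: "u \<noteq> v"
    and E: "\<And>e. e \<in> E \<Longrightarrow> finite e \<and> card e = k"
  obtains P where "linear_uv_path k u v P" "hypergraph P" "verts P \<subseteq> V" "edges P \<subseteq> E" "edges P \<noteq> {}"
proof -
  obtain l x y where p: "path_between k V E l x y u v"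
    using con by (auto simp: connected_in_def)
  show ?thesis
  proof (cases "l = 1")
    case True
    define e where "e = path_edge k x y 1"
    have e: "e \<in> E" using p True by (auto simp: path_between_def e_def)
    have "u \<in> e" "v \<in> e" using p True by (auto simp: path_between_def e_def path_edge_def)
    moreover have "e \<subseteq> V"
      using p True unfolding path_between_def e_def path_edge_def by (auto simp: image_subset_iff)
    ultimately show ?thesis
      using e E[OF e] uv
      by (intro that[of "Hypergraph e {e}"])
        (auto simp: linear_uv_path_def linear_path_length_one_def k_graph_def hypergraph_def)
  next
    case False
    define P where "P = Hypergraph (x ` {1..l + 1} \<union> (\<lambda>(i, j). y i j) ` ({1..l} \<times> {1..k - 2}))
      (path_edge k x y ` {1..l})"
    have l: "l \<ge> 2" using False p by (auto simp: path_between_def)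
    have "labelled_linear_path k l x y P"
      using p l unfolding labelled_linear_path_def path_between_def P_def by simp
    moreover have "u \<in> first_end k x y" "v \<in> last_end k l x y"
      using p by (auto simp: path_between_def first_end_def last_end_def)
    ultimately have "linear_uv_path k u v P" using uv unfolding linear_uv_path_def by blast
    moreover have "hypergraph P" unfolding hypergraph_def P_def path_edge_def by force
    ultimately show ?thesis
      using p l by (intro that[of P]) (auto simp: P_def path_between_def)
  qed
qed

section \<open>From unique paths to growth by leaf edges\<close>

lemma labelled_path_monochromatic:
  assumes p: "labelled_linear_path k l x y P"
    and edges: "\<And>e. e \<in> edges P \<Longrightarrow> e \<subseteq> A \<or> e \<inter> A = {}"
    and start: "first_end k x y \<inter> A \<noteq> {}"
  shows "last_end k l x y \<subseteq> A"
proof -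
  have l: "l \<ge> 2" and ed: "edges P = path_edge k x y ` {1..l}"
    using p by (auto simp: labelled_linear_path_def)
  have "path_edge k x y (Suc i) \<subseteq> A" if "Suc i \<le> l" for i
    using that
  proof (induction i)
    case 0
    have "first_end k x y \<subseteq> path_edge k x y 1" by (auto simp: first_end_def path_edge_def)
    moreover have "path_edge k x y 1 \<in> edges P" unfolding ed using l by (intro imageI) simp
    ultimately show ?case using start edges[of "path_edge k x y 1"] unfolding One_nat_def by blast
  next
    case (Suc i)
    then have "x (Suc i + 1) \<in> A" by (simp add: path_edge_def)
    moreover have "x (Suc i + 1) \<in> path_edge k x y (Suc (Suc i))" by (simp add: path_edge_def)
    moreover have "path_edge k x y (Suc (Suc i)) \<in> edges P"
      unfolding ed using Suc.prems by (intro imageI) simp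
    ultimately show ?case using edges[of "path_edge k x y (Suc (Suc i))"] by blast
  qed
  from this[of "l - 1"] l have "path_edge k x y l \<subseteq> A" by simp
  then show ?thesis by (auto simp: last_end_def path_edge_def)
qed

text \<open>Consecutive edges share a joint, so a path none of whose edges crosses between
  \<open>A\<close> and its complement stays on one side. Both \<open>A\<close> and
  \<open>- A\<close> are tried because the definition leaves open which end contains
  \<open>u\<close>.\<close>

lemma linear_uv_path_crossing:
  assumes p: "linear_uv_path k u v P" and u: "u \<in> A" and v: "v \<notin> A"
  obtains e where "e \<in> edges P" "e \<inter> A \<noteq> {}" "\<not> e \<subseteq> A"
proof -
  have "\<exists>e\<in>edges P. e \<inter> A \<noteq> {} \<and> \<not> e \<subseteq> A"
  proof (cases "linear_path_length_one k P \<and> u \<in> verts P \<and> v \<in> verts P")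
    case True
    then obtain e where e: "edges P = {e}"
      by (auto simp: linear_path_length_one_def card_1_singleton_iff)
    have "e = verts P"
      using True e by (intro card_subset_eq) (auto simp: linear_path_length_one_def k_graph_def hypergraph_def)
    then show ?thesis using True e u v by auto
  next
    case False
    then obtain l x y where l: "labelled_linear_path k l x y P"
      and ends: "u \<in> first_end k x y \<and> v \<in> last_end k l x y \<or> v \<in> first_end k x y \<and> u \<in> last_end k l x y"
      using p unfolding linear_uv_path_def by blast
    show ?thesis
    proof (rule ccontr)
      assume "\<not> ?thesis"
      then have "e \<subseteq> A \<or> e \<inter> A = {}" "e \<subseteq> - A \<or> e \<inter> - A = {}" if "e \<in> edges P" for e
        using that by auto
      then show False
        using ends u v labelled_path_monochromatic[OF l, of A] labelled_path_monochromatic[OF l, of "- A"]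
        by blast
    qed
  qed
  then show ?thesis using that by blast
qed

text \<open>Take a subtree with as many vertices as possible. If it missed a vertex, the path to
  that vertex would supply an edge leaving the subtree; uniqueness of paths makes this edge meet the
  subtree in a single vertex, so it could be attached as a leaf edge.\<close>

theorem linear_hypertree_htree:
  assumes T: "linear_hypertree k T" and k: "k \<ge> 2"
  shows "htree k (verts T) (edges T)"
proof -
  have fin: "finite (verts T)" and ne: "verts T \<noteq> {}"
    and TE: "\<And>e. e \<in> edges T \<Longrightarrow> e \<subseteq> verts T \<and> card e = k"
    and uniq: "\<And>u v. u \<in> verts T \<Longrightarrow> v \<in> verts T \<Longrightarrow> u \<noteq> v \<Longrightarrow>
      \<exists>!P. sub_hypergraph P T \<and> linear_uv_path k u v P"
    using T by (auto simp: linear_hypertree_def k_graph_def hypergraph_def)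
  define Q where "Q VE \<longleftrightarrow> htree k (fst VE) (snd VE) \<and> fst VE \<subseteq> verts T \<and> snd VE \<subseteq> edges T"
    for VE :: "'a set \<times> 'a set set"
  obtain x where "x \<in> verts T" using ne by auto
  then have "Q ({x}, {})" by (auto simp: Q_def intro: htree.vertex)
  moreover have "card (fst VE) \<le> card (verts T)" if "Q VE" for VE
    using that fin by (auto simp: Q_def intro: card_mono)
  ultimately obtain VE where "Q VE" and max: "\<And>VE'. Q VE' \<Longrightarrow> card (fst VE') \<le> card (fst VE)"
    using ex_has_greatest_nat[of Q "({x}, {})" "\<lambda>VE. card (fst VE)" "card (verts T) + 1"]
    by (metis le_imp_less_Suc Suc_eq_plus1)
  then obtain V E where VE: "VE = (V, E)" and tree: "htree k V E" and sub: "V \<subseteq> verts T" "E \<subseteq> edges T"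
    by (cases VE) (auto simp: Q_def)
  have finV: "finite V" using tree by (rule htree_finite)
  \<comment> \<open>Otherwise \<open>e\<close> and the path inside the subtree would be two linear paths from \<open>a\<close> to \<open>b\<close>.\<close>
  have no_chord: "e \<in> E" if e: "e \<in> edges T" and ab: "a \<in> e \<inter> V" "b \<in> e \<inter> V" "a \<noteq> b" for e a b
  proof (rule ccontr)
    assume "e \<notin> E"
    have Efin: "finite e' \<and> card e' = k" if "e' \<in> E" for e'
      using htree_edges(2,3)[OF tree that] finV finite_subset by blast
    obtain P where P: "linear_uv_path k a b P" "hypergraph P" "verts P \<subseteq> V" "edges P \<subseteq> E" "edges P \<noteq> {}"
      using connected_in_linear_uv_path[OF htree_connected[OF tree, of a b] ab(3) Efin] ab by blast
    have "sub_hypergraph P T" using P sub by (auto simp: sub_hypergraph_def)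
    moreover have "sub_hypergraph (Hypergraph e {e}) T"
      using TE[OF e] e fin finite_subset by (auto simp: sub_hypergraph_def hypergraph_def)
    moreover have "linear_uv_path k a b (Hypergraph e {e})"
      using ab TE[OF e] fin finite_subset
      by (auto simp: linear_uv_path_def linear_path_length_one_def k_graph_def hypergraph_def)
    moreover have "a \<in> verts T" "b \<in> verts T" using ab sub by auto
    ultimately have "P = Hypergraph e {e}" using uniq[of a b] P(1) ab(3) by blast
    then show False using P \<open>e \<notin> E\<close> by auto
  qed
  have "V = verts T"
  proof (rule ccontr)
    assume "V \<noteq> verts T"
    then obtain v where v: "v \<in> verts T" "v \<notin> V" using sub by auto
    obtain u where u: "u \<in> V" using tree by (cases rule: htree.cases) auto
    obtain P where P: "sub_hypergraph P T" "linear_uv_path k u v P"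
      using uniq[of u v] u v sub by blast
    obtain e where e: "e \<in> edges P" "e \<inter> V \<noteq> {}" "\<not> e \<subseteq> V"
      using linear_uv_path_crossing[OF P(2) u v(2)] by blast
    have eT: "e \<in> edges T" using e P by (auto simp: sub_hypergraph_def)
    have "e \<notin> E" using e htree_edges(2)[OF tree] by blast
    obtain z where z: "z \<in> e \<inter> V" using e by blast
    have "e \<inter> V = {z}" using no_chord[OF eT _ z] \<open>e \<notin> E\<close> z by blast
    then have "htree k (V \<union> e) (insert e E)"
      using TE[OF eT] fin finite_subset by (intro htree.leaf_edge[OF tree]) auto
    then have "Q (V \<union> e, insert e E)" using sub TE[OF eT] eT by (auto simp: Q_def)
    then have "card (V \<union> e) \<le> card V" using max VE by fastforce
    moreover have "card V < card (V \<union> e)"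
      using e finV TE[OF eT] fin finite_subset by (intro psubset_card_mono) auto
    ultimately show False by simp
  qed
  \<comment> \<open>Since \<open>k \<ge> 2\<close>, each edge of \<open>T\<close> has two vertices,
    both in \<open>V = verts T\<close>, and \<open>no_chord\<close> applies to them.\<close>
  moreover have "E = edges T"
  proof
    show "edges T \<subseteq> E"
    proof
      fix e assume e: "e \<in> edges T"
      then have "finite e" "card e \<ge> 2" using TE k fin finite_subset by blast+
      then obtain a b where "a \<in> e" "b \<in> e" "a \<noteq> b"
        by (metis card_le_Suc0_iff_eq not_less_eq_eq numeral_2_eq_2)
      then show "e \<in> E" using no_chord[OF e, of a b] TE[OF e] \<open>V = verts T\<close> by auto
    qed
  qed (rule sub)
  ultimately show ?thesis using tree by simp
qed

section \<open>Counting embeddings\<close>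

lemma card_inj_fixed_value:
  assumes "finite A" "finite B" "card A = k" "card B = k" "y \<in> A" "v \<in> B"
  shows "card {g \<in> A \<rightarrow>\<^sub>E B. inj_on g A \<and> g y = v} = fact (k - 1)"
proof -
  let ?H = "{h \<in> (A - {y}) \<rightarrow>\<^sub>E (B - {v}). inj_on h (A - {y})}"
  have eq: "{g \<in> A \<rightarrow>\<^sub>E B. inj_on g A \<and> g y = v} = (\<lambda>h. h(y := v)) ` ?H"
  proof (intro equalityI subsetI)
    fix g assume g: "g \<in> {g \<in> A \<rightarrow>\<^sub>E B. inj_on g A \<and> g y = v}"
    have "g(y := undefined) \<in> ?H"
    proof -
      have "g x \<noteq> v" if "x \<in> A - {y}" for x
        using g that assms(5) by (metis (mono_tags, lifting) DiffE inj_onD insertCI mem_Collect_eq)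
      moreover have "inj_on (g(y := undefined)) (A - {y})"
        using g by (auto simp: inj_on_def)
      ultimately show ?thesis using g by (auto simp: PiE_def extensional_def)
    qed
    moreover have "g = (g(y := undefined))(y := v)" using g by auto
    ultimately show "g \<in> (\<lambda>h. h(y := v)) ` ?H" by blast
  next
    fix g assume "g \<in> (\<lambda>h. h(y := v)) ` ?H"
    then obtain h where h: "h \<in> ?H" "g = h(y := v)" by auto
    have "h x \<in> B - {v}" if "x \<in> A" "x \<noteq> y" for x using h that by (auto simp: PiE_def)
    then show "g \<in> {g \<in> A \<rightarrow>\<^sub>E B. inj_on g A \<and> g y = v}"
      using h assms by (fastforce simp: PiE_def extensional_def inj_on_def)
  qed
  have "inj_on (\<lambda>h. h(y := v)) ?H"
  proof (rule inj_onI)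
    fix h h' assume h: "h \<in> ?H" "h' \<in> ?H" "h(y := v) = h'(y := v)"
    have "h y = undefined" "h' y = undefined" using h by (auto simp: PiE_def extensional_def)
    then show "h = h'" using h(3) by (metis fun_upd_triv fun_upd_upd)
  qed
  then have "card {g \<in> A \<rightarrow>\<^sub>E B. inj_on g A \<and> g y = v} = card ?H"
    unfolding eq by (rule card_image)
  also have "\<dots> = fact (k - 1)"
    using card_inj_on_subset_funcset[of "A - {y}" "B - {v}" "A - {y}"] assms
    by (simp add: fact_prod_rev)
  finally show ?thesis .
qed

text \<open>For objects determined by two restrictions: choose the first one, then the second one
  within the fibre that the first prescribes.\<close>

lemma card_le_pairs:
  assumes inj: "inj_on (\<lambda>s. (f s, g s)) S" and P: "finite P"
    and S: "\<And>s. s \<in> S \<Longrightarrow> f s \<in> P \<and> g s \<in> G (f s)"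
    and G: "\<And>p. p \<in> P \<Longrightarrow> finite (G p) \<and> card (G p) \<le> m"
  shows "card S \<le> card P * m"
proof -
  have "card S = card ((\<lambda>s. (f s, g s)) ` S)" using inj by (simp add: card_image)
  also have "\<dots> \<le> card (SIGMA p:P. G p)"
    using S P G by (intro card_mono finite_SigmaI) auto
  also have "\<dots> = (\<Sum>p\<in>P. card (G p))" using P G by simp
  also have "\<dots> \<le> (\<Sum>p\<in>P. m)" using G by (intro sum_mono) auto
  finally show ?thesis by simp
qed

context linear_k_graph begin

text \<open>Extensional functions make the set finite and let an embedding be determined by its
  values on \<open>X\<close>. Extra edges of the host on the image are allowed, since copies need
  not be induced.\<close>

definition embeddings :: "'a set \<Rightarrow> 'a set set \<Rightarrow> ('a \<Rightarrow> 'b) set" where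
  "embeddings X A = {\<phi> \<in> X \<rightarrow>\<^sub>E V. inj_on \<phi> X \<and> (\<forall>e\<in>A. \<phi> ` e \<in> E)}"

lemma finite_embeddings: "finite X \<Longrightarrow> finite (embeddings X A)"
  unfolding embeddings_def using finV by (intro finite_subset[OF _ finite_PiE[of X "\<lambda>_. V"]]) auto

text \<open>An injective map of a \<open>k\<close>-set into an edge \<open>f\<close> has image
  \<open>f\<close>. So the maps split by their image over the edges at \<open>v\<close>, with
  \<open>(k - 1)!\<close> maps for each.\<close>

lemma card_edge_maps:
  assumes e: "finite e" "card e = k" "y \<in> e"
  shows "card {g \<in> embeddings e {e}. g y = v} = fact (k - 1) * edeg E v"
proof -
  define B where "B f = {g \<in> e \<rightarrow>\<^sub>E f. inj_on g e \<and> g y = v}" for f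
  have im: "g ` e = f" if "f \<in> E" "g \<in> B f" for g f
    using that e cardE finite_edge by (intro card_subset_eq) (auto simp: B_def card_image)
  have "{g \<in> embeddings e {e}. g y = v} = (\<Union>f\<in>{f\<in>E. v \<in> f}. B f)"
  proof (intro equalityI subsetI)
    fix g assume g: "g \<in> {g \<in> embeddings e {e}. g y = v}"
    then have "g ` e \<in> {f\<in>E. v \<in> f}" "g \<in> B (g ` e)"
      using e by (auto simp: embeddings_def B_def PiE_def)
    then show "g \<in> (\<Union>f\<in>{f\<in>E. v \<in> f}. B f)" by blast
  next
    fix g assume "g \<in> (\<Union>f\<in>{f\<in>E. v \<in> f}. B f)"
    then obtain f where f: "f \<in> E" "g \<in> B f" by auto
    then show "g \<in> {g \<in> embeddings e {e}. g y = v}"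
      using im[OF f] EV[OF f(1)] by (auto simp: embeddings_def B_def PiE_def)
  qed
  also have "card \<dots> = (\<Sum>f\<in>{f\<in>E. v \<in> f}. card (B f))"
  proof (rule card_UN_disjoint)
    show "\<forall>f\<in>{f\<in>E. v \<in> f}. finite (B f)"
    proof
      fix f assume "f \<in> {f\<in>E. v \<in> f}"
      then have "finite (e \<rightarrow>\<^sub>E f)" using e finite_edge by (intro finite_PiE) auto
      then show "finite (B f)" unfolding B_def by simp
    qed
    show "\<forall>f\<in>{f\<in>E. v \<in> f}. \<forall>f'\<in>{f\<in>E. v \<in> f}. f \<noteq> f' \<longrightarrow> B f \<inter> B f' = {}"
      using im by blast
  qed (use finE in auto)
  also have "\<dots> = (\<Sum>f\<in>{f\<in>E. v \<in> f}. fact (k - 1))"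
    unfolding B_def using e cardE finite_edge by (intro sum.cong refl card_inj_fixed_value) auto
  finally show ?thesis by (simp add: edeg_def mult.commute)
qed

text \<open>By linearity the two prescribed values determine the image edge. The bound then counts
  all maps onto that edge with only the first value fixed.\<close>

lemma card_edge_maps_two_values:
  assumes e: "finite e" "card e = k" "y \<in> e" "y' \<in> e" "y \<noteq> y'"
  shows "card {g \<in> embeddings e {e}. g y = v \<and> g y' = v'} \<le> fact (k - 1)"
proof (cases "{g \<in> embeddings e {e}. g y = v \<and> g y' = v'} = {}")
  case False
  then obtain g\<^sub>0 where g\<^sub>0: "g\<^sub>0 \<in> embeddings e {e}" "g\<^sub>0 y = v" "g\<^sub>0 y' = v'" by auto
  define f where "f = g\<^sub>0 ` e"
  have f: "f \<in> E" "v \<in> f" "v' \<in> f" using g\<^sub>0 e by (auto simp: embeddings_def f_def)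
  have "v \<noteq> v'" using g\<^sub>0 e by (auto simp: embeddings_def inj_on_def)
  have "{g \<in> embeddings e {e}. g y = v \<and> g y' = v'} \<subseteq> {g \<in> e \<rightarrow>\<^sub>E f. inj_on g e \<and> g y = v}"
  proof
    fix g assume g: "g \<in> {g \<in> embeddings e {e}. g y = v \<and> g y' = v'}"
    then have "g ` e \<in> E" "v \<in> g ` e" "v' \<in> g ` e" using e by (auto simp: embeddings_def)
    then have "g ` e = f" using edge_unique f \<open>v \<noteq> v'\<close> by blast
    then show "g \<in> {g \<in> e \<rightarrow>\<^sub>E f. inj_on g e \<and> g y = v}"
      using g by (auto simp: embeddings_def PiE_def)
  qed
  then have "card {g \<in> embeddings e {e}. g y = v \<and> g y' = v'}
      \<le> card {g \<in> e \<rightarrow>\<^sub>E f. inj_on g e \<and> g y = v}"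
    using e finite_edge[OF f(1)] by (intro card_mono finite_subset[OF _ finite_PiE[of e "\<lambda>_. f"]]) auto
  also have "\<dots> = fact (k - 1)"
    using e f cardE finite_edge by (intro card_inj_fixed_value) auto
  finally show ?thesis .
next
  case True
  then show ?thesis by (simp only: card.empty)
qed

lemma embeddings_restrict:
  assumes "\<phi> \<in> embeddings (X \<union> e) (insert e A)" "\<And>a. a \<in> A \<Longrightarrow> a \<subseteq> X"
  shows "restrict \<phi> X \<in> embeddings X A" "restrict \<phi> e \<in> embeddings e {e}"
proof -
  have "restrict \<phi> X ` a = \<phi> ` a" if "a \<in> A" for a
    using assms(2)[OF that] by (intro image_cong) auto
  then show "restrict \<phi> X \<in> embeddings X A"
    using assms(1) by (auto simp: embeddings_def inj_on_def)
  show "restrict \<phi> e \<in> embeddings e {e}"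
    using assms(1) by (auto simp: embeddings_def inj_on_def)
qed

lemma embeddings_restrict_inj:
  "inj_on (\<lambda>\<phi>. (restrict \<phi> X, restrict \<phi> e)) (embeddings (X \<union> e) B)"
  "inj_on (\<lambda>\<phi>. (restrict \<phi> e, restrict \<phi> X)) (embeddings (X \<union> e) B)"
proof -
  have "\<phi> = \<psi>" if "\<phi> \<in> embeddings (X \<union> e) B" "\<psi> \<in> embeddings (X \<union> e) B"
    and X: "restrict \<phi> X = restrict \<psi> X" and e: "restrict \<phi> e = restrict \<psi> e" for \<phi> \<psi>
  proof (rule extensionalityI[of _ "X \<union> e"])
    show "\<phi> x = \<psi> x" if x: "x \<in> X \<union> e" for x
      using x fun_cong[OF X, of x] fun_cong[OF e, of x] by (auto split: if_splits)
  qed (use that in \<open>auto simp: embeddings_def PiE_def\<close>)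
  then show "inj_on (\<lambda>\<phi>. (restrict \<phi> X, restrict \<phi> e)) (embeddings (X \<union> e) B)"
    "inj_on (\<lambda>\<phi>. (restrict \<phi> e, restrict \<phi> X)) (embeddings (X \<union> e) B)"
    by (auto simp: inj_on_def)
qed

lemma htree_new_edge:
  assumes "htree k X A" "card e = k" "e \<inter> X = {z}"
  shows "e \<notin> A"
proof
  assume "e \<in> A"
  then have "e = {z}" using htree_edges(2)[OF assms(1)] assms(3) by blast
  then show False using assms(2) k by simp
qed

text \<open>A map excluded by the condition on \<open>Y\<close> sends some vertex of
  \<open>e - {z}\<close> to some point of \<open>Y\<close>. There are at most
  \<open>k * card Y\<close> such pairs, and each is a second prescribed value, hence leaves at most
  \<open>(k - 1)!\<close> maps.\<close>

lemma card_good_edge_maps: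
  assumes e: "finite e" "card e = k" "z \<in> e" and Y: "finite Y"
  shows "real (card {g \<in> embeddings e {e}. g z = v \<and> g ` (e - {z}) \<inter> Y = {}})
    \<ge> fact (k - 1) * (real (edeg E v) - real k * real (card Y))"
proof -
  let ?G = "{g \<in> embeddings e {e}. g z = v \<and> g ` (e - {z}) \<inter> Y = {}}"
  let ?B = "\<Union>p\<in>(e - {z}) \<times> Y. {g \<in> embeddings e {e}. g z = v \<and> g (fst p) = snd p}"
  have fin: "finite (embeddings e {e})" using e by (simp add: finite_embeddings)
  have "card ?B \<le> (\<Sum>p\<in>(e - {z}) \<times> Y. card {g \<in> embeddings e {e}. g z = v \<and> g (fst p) = snd p})"
    using e Y by (intro card_UN_le) auto
  also have "\<dots> \<le> (\<Sum>p\<in>(e - {z}) \<times> Y. fact (k - 1))"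
    using e by (intro sum_mono card_edge_maps_two_values) auto
  also have "\<dots> = card (e - {z}) * card Y * fact (k - 1)" by (simp add: card_cartesian_product)
  also have "\<dots> \<le> k * card Y * fact (k - 1)"
    using e by (intro mult_right_mono) auto
  finally have B: "card ?B \<le> k * card Y * fact (k - 1)" .
  have "fact (k - 1) * edeg E v = card {g \<in> embeddings e {e}. g z = v}"
    using card_edge_maps[OF e] by simp
  also have "\<dots> \<le> card (?G \<union> ?B)"
    using fin by (intro card_mono finite_subset[of "?G \<union> ?B" "embeddings e {e}"]) auto
  also have "\<dots> \<le> card ?G + card ?B" by (rule card_Un_le)
  finally have "fact (k - 1) * edeg E v \<le> card ?G + k * card Y * fact (k - 1)" using B by linarith
  then have "real (fact (k - 1) * edeg E v) \<le> real (card ?G + k * card Y * fact (k - 1))"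
    by (rule of_nat_mono)
  then show ?thesis by (simp add: algebra_simps)
qed

text \<open>As \<open>z\<close> is the only common vertex, an embedding of \<open>X\<close> and a
  map of \<open>e\<close> that agree at \<open>z\<close> and are otherwise disjoint glue to an
  embedding of the larger tree, from which both can be recovered.\<close>

lemma card_embeddings_extend:
  assumes X: "finite X" and A: "\<And>a. a \<in> A \<Longrightarrow> a \<subseteq> X" and e: "finite e" "card e = k" "e \<inter> X = {z}"
  shows "(\<Sum>\<phi>\<in>embeddings X A. real (card {g \<in> embeddings e {e}. g z = \<phi> z \<and> g ` (e - {z}) \<inter> \<phi> ` X = {}}))
    \<le> real (card (embeddings (X \<union> e) (insert e A)))"
proof -
  let ?G = "\<lambda>\<phi>. {g \<in> embeddings e {e}. g z = \<phi> z \<and> g ` (e - {z}) \<inter> \<phi> ` X = {}}"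
  define J where "J = (\<lambda>(\<phi>, g) x. if x \<in> X then \<phi> x else if x \<in> e then g x else undefined :: 'b)"
  have z: "z \<in> X" "z \<in> e" using e by auto
  have J_e: "J (\<phi>, g) x = g x" if "g \<in> ?G \<phi>" "x \<in> e" for \<phi> g x
  proof (cases "x \<in> X")
    case True
    then have "x = z" using e that by auto
    then show ?thesis using True that by (simp add: J_def)
  qed (use that in \<open>simp add: J_def\<close>)
  have J_X: "J (\<phi>, g) x = \<phi> x" if "x \<in> X" for \<phi> g x using that by (simp add: J_def)
  have "inj_on J (SIGMA \<phi>:embeddings X A. ?G \<phi>)"
  proof (rule inj_onI, clarify)
    fix \<phi> g \<phi>' g' assume a: "\<phi> \<in> embeddings X A" "\<phi>' \<in> embeddings X A" "J (\<phi>, g) = J (\<phi>', g')"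
      "g \<in> embeddings e {e}" "g z = \<phi> z" "g ` (e - {z}) \<inter> \<phi> ` X = {}"
      "g' \<in> embeddings e {e}" "g' z = \<phi>' z" "g' ` (e - {z}) \<inter> \<phi>' ` X = {}"
    have "\<phi> = \<phi>'"
    proof (rule extensionalityI[of _ X])
      show "\<phi> x = \<phi>' x" if "x \<in> X" for x using J_X[OF that] a(3) by metis
    qed (use a in \<open>auto simp: embeddings_def PiE_def\<close>)
    moreover have "g = g'"
    proof (rule extensionalityI[of _ e])
      show "g x = g' x" if "x \<in> e" for x
        using J_e[of g \<phi> x] J_e[of g' \<phi>' x] that a by simp
    qed (use a in \<open>auto simp: embeddings_def PiE_def\<close>)
    ultimately show "\<phi> = \<phi>' \<and> g = g'" by simp
  qed
  moreover have "J ` (SIGMA \<phi>:embeddings X A. ?G \<phi>) \<subseteq> embeddings (X \<union> e) (insert e A)"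
  proof clarify
    fix \<phi> g assume \<phi>: "\<phi> \<in> embeddings X A" and g: "g \<in> embeddings e {e}" "g z = \<phi> z" "g ` (e - {z}) \<inter> \<phi> ` X = {}"
    have Je: "J (\<phi>, g) x = g x" if "x \<in> e" for x using J_e g that by simp
    have ie: "J (\<phi>, g) ` e = g ` e" using Je by (intro image_cong) auto
    have iX: "J (\<phi>, g) ` X = \<phi> ` X" by (intro image_cong J_X) auto
    have iA: "J (\<phi>, g) ` a = \<phi> ` a" if "a \<in> A" for a
      using A[OF that] by (intro image_cong J_X) auto
    have un: "X \<union> e = X \<union> (e - {z})" using z by auto
    have "inj_on (J (\<phi>, g)) (X \<union> (e - {z}))"
      unfolding inj_on_Un
    proof (intro conjI)
      show "inj_on (J (\<phi>, g)) X" using \<phi> J_X by (auto simp: embeddings_def inj_on_def)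
      show "inj_on (J (\<phi>, g)) (e - {z})" using g Je by (auto simp: embeddings_def inj_on_def)
      have "J (\<phi>, g) ` (e - {z}) = g ` (e - {z})" using Je by (intro image_cong) auto
      then show "J (\<phi>, g) ` (X - (e - {z})) \<inter> J (\<phi>, g) ` (e - {z} - X) = {}"
        using g(3) iX by blast
    qed
    moreover have "J (\<phi>, g) \<in> (X \<union> e) \<rightarrow>\<^sub>E V"
      using \<phi> g by (auto simp: embeddings_def PiE_def J_def extensional_def)
    ultimately show "J (\<phi>, g) \<in> embeddings (X \<union> e) (insert e A)"
      using \<phi> g ie iA unfolding embeddings_def un[symmetric] by auto
  qed
  ultimately have "card (SIGMA \<phi>:embeddings X A. ?G \<phi>) \<le> card (embeddings (X \<union> e) (insert e A))"
    using X e by (intro card_inj_on_le finite_embeddings) auto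
  moreover have "card (SIGMA \<phi>:embeddings X A. ?G \<phi>) = (\<Sum>\<phi>\<in>embeddings X A. card (?G \<phi>))"
    using X e by (simp add: finite_embeddings)
  ultimately show ?thesis by (simp flip: of_nat_sum)
qed

section \<open>Embedding counts under an upper bound on the degrees\<close>

context
  fixes D :: nat
  assumes maxdeg: "\<And>v. v \<in> V \<Longrightarrow> edeg E v \<le> D"
begin

lemma edeg_le_D: "edeg E v \<le> D"
proof (cases "v \<in> V")
  case False
  then have "{e\<in>E. v \<in> e} = {}" using EV by auto
  then have "edeg E v = 0" unfolding edeg_def by (metis card.empty)
  then show ?thesis by simp
qed (rule maxdeg)

lemma card_edge_maps_le:
  assumes "finite e" "card e = k" "y \<in> e"
  shows "card {g \<in> embeddings e {e}. g y = v} \<le> fact (k - 1) * D"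
  using card_edge_maps[OF assms] edeg_le_D by simp

text \<open>The root may be any vertex. If \<open>x\<close> belongs to the old tree, that tree is
  embedded before the new edge; otherwise the new edge is mapped first and prescribes the image of
  \<open>z\<close>. Each edge contributes a factor \<open>(k - 1)! * D\<close>.\<close>

lemma card_embeddings_at:
  assumes "htree k X A" "x \<in> X"
  shows "card {\<phi> \<in> embeddings X A. \<phi> x = v} \<le> (fact (k - 1) * D) ^ card A"
  using assms
proof (induction arbitrary: x v rule: htree.induct)
  case (vertex x')
  have "{\<phi> \<in> embeddings {x'} {}. \<phi> x = v} \<subseteq> {restrict (\<lambda>_. v) {x'}}"
  proof
    fix \<phi> assume "\<phi> \<in> {\<phi> \<in> embeddings {x'} {}. \<phi> x = v}"
    then have "\<phi> = restrict (\<lambda>_. v) {x'}"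
      using vertex by (intro extensionalityI[of _ "{x'}"]) (auto simp: embeddings_def PiE_def)
    then show "\<phi> \<in> {restrict (\<lambda>_. v) {x'}}" by simp
  qed
  then have "card {\<phi> \<in> embeddings {x'} {}. \<phi> x = v} \<le> card {restrict (\<lambda>_. v) {x'}}"
    by (intro card_mono) auto
  then show ?case by simp
next
  case (leaf_edge X A e z)
  define M where "M = (fact (k - 1) * D) ^ card A"
  have z: "z \<in> X" "z \<in> e" using leaf_edge by auto
  have new: "e \<notin> A" by (rule htree_new_edge[OF leaf_edge.hyps(1,3,4)])
  have finX: "finite X" and finA: "finite A" and A: "\<And>a. a \<in> A \<Longrightarrow> a \<subseteq> X"
    using htree_finite[OF leaf_edge.hyps(1)] htree_edges(1,2)[OF leaf_edge.hyps(1)] by auto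
  let ?S = "{\<phi> \<in> embeddings (X \<union> e) (insert e A). \<phi> x = v}"
  have card_insert: "(fact (k - 1) * D) ^ card (insert e A) = M * (fact (k - 1) * D)"
    using new finA by (simp add: M_def mult_ac)
  have sub: "?S \<subseteq> embeddings (X \<union> e) (insert e A)" by auto
  show ?case
  proof (cases "x \<in> X")
    case True
    have "card ?S \<le> card {\<phi> \<in> embeddings X A. \<phi> x = v} * (fact (k - 1) * D)"
      by (rule card_le_pairs[OF inj_on_subset[OF embeddings_restrict_inj(1) sub],
            where G = "\<lambda>p. {g \<in> embeddings e {e}. g z = p z}"])
        (use z True finX leaf_edge.hyps(2) embeddings_restrict[OF _ A]
            card_edge_maps_le[OF leaf_edge.hyps(2,3) z(2)] in \<open>auto simp: finite_embeddings\<close>)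
    also have "\<dots> \<le> M * (fact (k - 1) * D)"
      unfolding M_def using leaf_edge.IH True by (intro mult_right_mono) auto
    finally show ?thesis unfolding card_insert .
  next
    case False
    then have x: "x \<in> e" using leaf_edge.prems by auto
    have "card ?S \<le> card {g \<in> embeddings e {e}. g x = v} * M"
      by (rule card_le_pairs[OF inj_on_subset[OF embeddings_restrict_inj(2) sub],
            where G = "\<lambda>p. {\<phi> \<in> embeddings X A. \<phi> z = p z}"])
        (use z x finX leaf_edge.hyps(2) embeddings_restrict[OF _ A] leaf_edge.IH[of z] in
          \<open>auto simp: finite_embeddings M_def\<close>)
    also have "\<dots> \<le> (fact (k - 1) * D) * M"
      using card_edge_maps_le[OF leaf_edge.hyps(2,3) x] by (intro mult_right_mono) auto
    finally show ?thesis unfolding card_insert by (simp only: mult.commute)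
  qed
qed

text \<open>Prescribing a second vertex saves a factor \<open>D\<close>: at some stage of the
  construction an edge has two prescribed values and admits at most \<open>(k - 1)!\<close> maps by
  linearity. The saving is written as a product to stay within natural numbers.\<close>

lemma card_embeddings_at_two:
  assumes "htree k X A" "x \<in> X" "y \<in> X" "x \<noteq> y"
  shows "card {\<phi> \<in> embeddings X A. \<phi> x = u \<and> \<phi> y = v} * D \<le> (fact (k - 1) * D) ^ card A"
  using assms
proof (induction arbitrary: x y u v rule: htree.induct)
  case (vertex x')
  then show ?case by simp
next
  case (leaf_edge X A e z)
  define M where "M = (fact (k - 1) * D) ^ card A"
  have z: "z \<in> X" "z \<in> e" using leaf_edge by auto
  have new: "e \<notin> A" by (rule htree_new_edge[OF leaf_edge.hyps(1,3,4)])
  have finX: "finite X" and finA: "finite A" and A: "\<And>a. a \<in> A \<Longrightarrow> a \<subseteq> X"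
    using htree_finite[OF leaf_edge.hyps(1)] htree_edges(1,2)[OF leaf_edge.hyps(1)] by auto
  have card_insert: "(fact (k - 1) * D) ^ card (insert e A) = M * (fact (k - 1) * D)"
    using new finA by (simp add: M_def mult_ac)
  let ?S = "\<lambda>x y u v. {\<phi> \<in> embeddings (X \<union> e) (insert e A). \<phi> x = u \<and> \<phi> y = v}"
  have sub: "?S x y u v \<subseteq> embeddings (X \<union> e) (insert e A)" for x y u v by auto
  have at: "card {\<phi> \<in> embeddings X A. \<phi> a = b} \<le> M" if "a \<in> X" for a b
    unfolding M_def by (rule card_embeddings_at[OF leaf_edge.hyps(1) that])
  have mixed: "card (?S a b u v) \<le> M * fact (k - 1)" if "a \<in> X" "b \<in> e" "b \<notin> X" for a b u v
  proof -
    have zb: "z \<noteq> b" using z that by blast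
    have "card (?S a b u v) \<le> card {\<phi> \<in> embeddings X A. \<phi> a = u} * fact (k - 1)"
      by (rule card_le_pairs[OF inj_on_subset[OF embeddings_restrict_inj(1) sub],
            where G = "\<lambda>p. {g \<in> embeddings e {e}. g z = p z \<and> g b = v}"])
        (use z that finX leaf_edge.hyps(2) embeddings_restrict[OF _ A]
            card_edge_maps_two_values[OF leaf_edge.hyps(2,3) z(2) that(2) zb] in \<open>auto simp: finite_embeddings\<close>)
    also have "\<dots> \<le> M * fact (k - 1)" using at that by (intro mult_right_mono) auto
    finally show ?thesis .
  qed
  consider "x \<in> X" "y \<in> X" | "x \<in> X" "y \<in> e" "y \<notin> X" | "y \<in> X" "x \<in> e" "x \<notin> X" | "x \<in> e" "y \<in> e"
    using leaf_edge.prems by blast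
  then show ?case
  proof cases
    case 1
    have "card (?S x y u v) \<le> card {\<phi> \<in> embeddings X A. \<phi> x = u \<and> \<phi> y = v} * (fact (k - 1) * D)"
      by (rule card_le_pairs[OF inj_on_subset[OF embeddings_restrict_inj(1) sub],
            where G = "\<lambda>p. {g \<in> embeddings e {e}. g z = p z}"])
        (use z 1 finX leaf_edge.hyps(2) embeddings_restrict[OF _ A]
            card_edge_maps_le[OF leaf_edge.hyps(2,3) z(2)] in \<open>auto simp: finite_embeddings\<close>)
    then have "card (?S x y u v) * D
        \<le> card {\<phi> \<in> embeddings X A. \<phi> x = u \<and> \<phi> y = v} * (fact (k - 1) * D) * D"
      by (rule mult_right_mono) simp
    also have "\<dots> = card {\<phi> \<in> embeddings X A. \<phi> x = u \<and> \<phi> y = v} * D * (fact (k - 1) * D)"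
      by (simp only: mult_ac)
    also have "\<dots> \<le> M * (fact (k - 1) * D)"
      unfolding M_def using leaf_edge.IH 1 leaf_edge.prems by (intro mult_right_mono) auto
    finally show ?thesis unfolding card_insert .
  next
    case 2
    have "card (?S x y u v) * D \<le> M * fact (k - 1) * D" using mixed[OF 2] by (intro mult_right_mono) auto
    then show ?thesis unfolding card_insert by (simp only: mult_ac)
  next
    case 3
    have "?S x y u v = ?S y x v u" by auto
    then have "card (?S x y u v) * D \<le> M * fact (k - 1) * D"
      using mixed[OF 3, of v u] by (intro mult_right_mono) auto
    then show ?thesis unfolding card_insert by (simp only: mult_ac)
  next
    case 4
    have "card (?S x y u v) \<le> card {g \<in> embeddings e {e}. g x = u \<and> g y = v} * M"
      by (rule card_le_pairs[OF inj_on_subset[OF embeddings_restrict_inj(2) sub],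
            where G = "\<lambda>p. {\<phi> \<in> embeddings X A. \<phi> z = p z}"])
        (use z 4 finX leaf_edge.hyps(2) embeddings_restrict[OF _ A] at[OF z(1)] in
          \<open>auto simp: finite_embeddings\<close>)
    also have "\<dots> \<le> fact (k - 1) * M"
      using card_edge_maps_two_values[OF leaf_edge.hyps(2,3) 4 leaf_edge.prems(3)]
      by (intro mult_right_mono) auto
    finally have "card (?S x y u v) * D \<le> fact (k - 1) * M * D" by (rule mult_right_mono) simp
    then show ?thesis unfolding card_insert by (simp only: mult_ac)
  qed
qed

lemma card_embeddings_le:
  assumes "htree k X A" "x \<in> X"
  shows "card (embeddings X A) \<le> card V * (fact (k - 1) * D) ^ card A"
proof -
  have "inj_on (\<lambda>\<phi>. (\<phi> x, \<phi>)) (embeddings X A)" by (auto simp: inj_on_def)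
  then show ?thesis
  proof (rule card_le_pairs[where G = "\<lambda>v. {\<phi> \<in> embeddings X A. \<phi> x = v}"])
    show "\<phi> x \<in> V \<and> \<phi> \<in> {\<psi> \<in> embeddings X A. \<psi> x = \<phi> x}" if "\<phi> \<in> embeddings X A" for \<phi>
      using that assms(2) by (auto simp: embeddings_def)
    show "finite {\<phi> \<in> embeddings X A. \<phi> x = v} \<and>
        card {\<phi> \<in> embeddings X A. \<phi> x = v} \<le> (fact (k - 1) * D) ^ card A" for v
      using finite_embeddings[OF htree_finite[OF assms(1)]] card_embeddings_at[OF assms] by simp
  qed (rule finV)
qed

text \<open>Extending an embedding \<open>\<phi>\<close> by a leaf edge at \<open>z\<close> loses,
  relative to \<open>(k - 1)! * D\<close>, the deficit at \<open>\<phi> z\<close> and the maps that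
  collide with the image. The upper bound \<open>card_embeddings_at\<close> controls the summed
  deficits: each vertex serves as \<open>\<phi> z\<close> at most \<open>M\<close> times, so
  together they are at most \<open>M * \<Delta>\<close>.\<close>

lemma card_embeddings_ge:
  assumes "htree k X A"
  defines "\<Delta> \<equiv> \<Sum>v\<in>V. real D - real (edeg E v)"
  shows "real ((fact (k - 1) * D) ^ card A) * (real (card V) * real D
      - real (card A) * (\<Delta> + real (card V) * real k * real (card X)))
    \<le> real (card (embeddings X A)) * real D"
  using assms(1)
proof (induction rule: htree.induct)
  case (vertex x)
  have "(\<lambda>v. restrict (\<lambda>_. v) {x}) ` V \<subseteq> embeddings {x} {}"
    by (auto simp: embeddings_def split: if_splits)
  moreover have "inj_on (\<lambda>v. restrict (\<lambda>_. v) {x}) V"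
    by (auto simp: inj_on_def dest: fun_cong[where x = x])
  ultimately have "card V \<le> card (embeddings {x} {})"
    by (intro card_inj_on_le finite_embeddings) auto
  then show ?case by (simp add: mult_right_mono)
next
  case (leaf_edge X A e z)
  define M where "M = real ((fact (k - 1) * D) ^ card A)"
  define c where "c = (fact (k - 1) :: real)"
  define n where "n = real (card V)"
  define N where "N = real (card (embeddings X A))"
  have c: "c > 0" by (simp add: c_def)
  have z: "z \<in> X" "z \<in> e" using leaf_edge by auto
  have new: "e \<notin> A" by (rule htree_new_edge[OF leaf_edge.hyps(1,3,4)])
  have finX: "finite X" and finA: "finite A" and A: "\<And>a. a \<in> A \<Longrightarrow> a \<subseteq> X"
    using htree_finite[OF leaf_edge.hyps(1)] htree_edges(1,2)[OF leaf_edge.hyps(1)] by auto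
  have fin: "finite (embeddings X A)" by (rule finite_embeddings[OF finX])
  have M': "real ((fact (k - 1) * D) ^ card (insert e A)) = c * real D * M"
    using new finA by (simp add: M_def c_def)
  have M0: "M \<ge> 0" by (simp add: M_def)
  have NM: "N \<le> n * M"
    using of_nat_mono[OF card_embeddings_le[OF leaf_edge.hyps(1) z(1)], where 'a = real]
    by (simp add: N_def n_def M_def)
  have "(\<Sum>\<phi>\<in>embeddings X A. real D - real (edeg E (\<phi> z)))
      = (\<Sum>v\<in>V. \<Sum>\<phi>\<in>{\<phi>\<in>embeddings X A. \<phi> z = v}. real D - real (edeg E (\<phi> z)))"
    using fin finV z by (intro sum.group[symmetric]) (auto simp: embeddings_def)
  also have "\<dots> = (\<Sum>v\<in>V. real (card {\<phi>\<in>embeddings X A. \<phi> z = v}) * (real D - real (edeg E v)))"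
    by (intro sum.cong refl) simp
  also have "\<dots> \<le> (\<Sum>v\<in>V. M * (real D - real (edeg E v)))"
    unfolding M_def using card_embeddings_at[OF leaf_edge.hyps(1) z(1)] maxdeg
    by (intro sum_mono mult_right_mono of_nat_mono) auto
  finally have def: "(\<Sum>\<phi>\<in>embeddings X A. real D - real (edeg E (\<phi> z))) \<le> M * \<Delta>"
    by (simp add: \<Delta>_def sum_distrib_left)
  have "c * (N * real D - M * \<Delta> - real k * real (card X) * N)
      \<le> c * (N * real D - (\<Sum>\<phi>\<in>embeddings X A. real D - real (edeg E (\<phi> z))) - real k * real (card X) * N)"
    using def c by (intro mult_left_mono) auto
  also have "\<dots> = (\<Sum>\<phi>\<in>embeddings X A. c * (real (edeg E (\<phi> z)) - real k * real (card X)))"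
    by (simp add: N_def sum_subtractf algebra_simps flip: sum_distrib_left)
  also have "\<dots> \<le> (\<Sum>\<phi>\<in>embeddings X A. c * (real (edeg E (\<phi> z)) - real k * real (card (\<phi> ` X))))"
    using c finX by (intro sum_mono mult_left_mono diff_left_mono) (auto intro: card_image_le)
  also have "\<dots> \<le> (\<Sum>\<phi>\<in>embeddings X A.
      real (card {g \<in> embeddings e {e}. g z = \<phi> z \<and> g ` (e - {z}) \<inter> \<phi> ` X = {}}))"
    unfolding c_def using finX leaf_edge z by (intro sum_mono card_good_edge_maps) auto
  also have "\<dots> \<le> real (card (embeddings (X \<union> e) (insert e A)))"
    using finX A leaf_edge by (intro card_embeddings_extend) auto
  finally have "c * (N * real D - M * \<Delta> - real k * real (card X) * N) * real D
      \<le> real (card (embeddings (X \<union> e) (insert e A))) * real D"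
    by (rule mult_right_mono) simp
  moreover have "c * real D * M * (n * real D - real (card (insert e A)) * (\<Delta> + n * real k * real (card (X \<union> e))))
      \<le> c * (N * real D - M * \<Delta> - real k * real (card X) * N) * real D"
  proof -
    \<comment> \<open>The new edge adds one copy of \<open>q\<close>. Times \<open>M\<close>, it
      pays for the deficits \<open>M * \<Delta>\<close> and, because \<open>N \<le> n * M\<close>,
      for the collisions.\<close>
    define q where "q = \<Delta> + n * real k * real (card X)"
    have q: "q \<le> \<Delta> + n * real k * real (card (X \<union> e))"
      unfolding q_def n_def using finX leaf_edge
      by (intro add_left_mono mult_left_mono of_nat_mono card_mono) auto
    have "M * (n * real D - real (card (insert e A)) * (\<Delta> + n * real k * real (card (X \<union> e))))
        \<le> M * (n * real D - real (card (insert e A)) * q)"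
      using q M0 by (intro mult_left_mono diff_left_mono) auto
    also have "\<dots> = M * (n * real D - real (card A) * q) - M * q"
      using new finA by (simp add: algebra_simps)
    also have "\<dots> \<le> N * real D - M * q"
      using leaf_edge.IH unfolding M_def N_def n_def q_def by simp
    also have "\<dots> \<le> N * real D - M * \<Delta> - real k * real (card X) * N"
      using mult_left_mono[OF NM, of "real k * real (card X)"] by (simp add: q_def algebra_simps)
    finally have "c * real D * (M * (n * real D - real (card (insert e A)) * (\<Delta> + n * real k * real (card (X \<union> e)))))
        \<le> c * real D * (N * real D - M * \<Delta> - real k * real (card X) * N)"
      using c by (intro mult_left_mono) auto
    then show ?thesis by (simp only: mult_ac)
  qed
  ultimately show ?case unfolding M' n_def by linarith
qed

end

end

section \<open>Tree tilings\<close>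

context linear_k_graph begin

text \<open>With \<open>t = card X\<close>, a vertex is hit through each of the \<open>t\<close>
  tree vertices by at most \<open>M\<close> embeddings, so the weight \<open>1 / (t * M)\<close>
  makes degrees at most 1. A pair is hit through at most \<open>t^2\<close> pairs of tree vertices,
  each by at most \<open>M / D\<close> embeddings, so codegrees are at most
  \<open>t / D\<close>.\<close>

lemma embeddings_weighted_family:
  fixes D :: nat and \<gamma> :: real
  assumes tree: "htree k X A" and ne: "X \<noteq> {}"
    and D: "D \<ge> 1" and maxdeg: "\<And>v. v \<in> V \<Longrightarrow> edeg E v \<le> D"
    and \<gamma>: "real (card X) / real D \<le> \<gamma>"
  defines "M \<equiv> (fact (k - 1) * D) ^ card A"
  shows "weighted_family V (embeddings X A) (\<lambda>\<phi>. \<phi> ` X) (\<lambda>_. 1 / (real (card X) * real M)) (card X) \<gamma>"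
proof -
  define t where "t = card X"
  have finX: "finite X" by (rule htree_finite[OF tree])
  have t: "t \<ge> 1" using finX ne by (simp add: t_def Suc_le_eq card_gt_0_iff)
  have M: "real M > 0" using D by (simp add: M_def)
  have tM: "real t * real M > 0" using t M by simp
  have fin: "finite (embeddings X A)" by (rule finite_embeddings[OF finX])
  have deg: "wdeg (embeddings X A) (\<lambda>\<phi>. \<phi> ` X) (\<lambda>_. 1 / (real t * real M)) v \<le> 1" for v
  proof -
    have "{\<phi> \<in> embeddings X A. v \<in> \<phi> ` X} = (\<Union>x\<in>X. {\<phi> \<in> embeddings X A. \<phi> x = v})" by auto
    then have "card {\<phi> \<in> embeddings X A. v \<in> \<phi> ` X} \<le> (\<Sum>x\<in>X. card {\<phi> \<in> embeddings X A. \<phi> x = v})"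
      using card_UN_le[OF finX] by simp
    also have "\<dots> \<le> (\<Sum>x\<in>X. M)"
      unfolding M_def by (intro sum_mono card_embeddings_at maxdeg tree)
    finally have "real (card {\<phi> \<in> embeddings X A. v \<in> \<phi> ` X}) \<le> real (t * M)"
      unfolding t_def by (intro of_nat_mono) simp
    then show ?thesis using tM by (simp add: wdeg_def)
  qed
  have codeg: "wcodeg (embeddings X A) (\<lambda>\<phi>. \<phi> ` X) (\<lambda>_. 1 / (real t * real M)) u v \<le> \<gamma>"
    if uv: "u \<noteq> v" for u v
  proof -
    let ?P = "\<lambda>p. {\<phi> \<in> embeddings X A. \<phi> (fst p) = u \<and> \<phi> (snd p) = v}"
    have eq: "{\<phi> \<in> embeddings X A. u \<in> \<phi> ` X \<and> v \<in> \<phi> ` X} = (\<Union>p\<in>X \<times> X. ?P p)" by auto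
    have pair: "card (?P p) * D \<le> M" if "p \<in> X \<times> X" for p
    proof (cases "fst p = snd p")
      case True
      then have "?P p = {}" using uv by auto
      then show ?thesis by (metis card.empty mult_0 zero_le)
    next
      case False
      then show ?thesis
        unfolding M_def using that by (intro card_embeddings_at_two maxdeg tree) auto
    qed
    have "card {\<phi> \<in> embeddings X A. u \<in> \<phi> ` X \<and> v \<in> \<phi> ` X} * D \<le> (\<Sum>p\<in>X \<times> X. card (?P p)) * D"
      unfolding eq using finX by (intro mult_right_mono card_UN_le) auto
    also have "\<dots> \<le> (\<Sum>p\<in>X \<times> X. M)"
      unfolding sum_distrib_right by (intro sum_mono pair)
    also have "\<dots> = t * t * M" by (simp add: t_def card_cartesian_product)
    finally have "real (card {\<phi> \<in> embeddings X A. u \<in> \<phi> ` X \<and> v \<in> \<phi> ` X} * D) \<le> real (t * t * M)"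
      by (rule of_nat_mono)
    then have "real (card {\<phi> \<in> embeddings X A. u \<in> \<phi> ` X \<and> v \<in> \<phi> ` X}) / (real t * real M) \<le> real t / real D"
      using tM D by (simp add: field_simps)
    then show ?thesis using \<gamma> by (simp add: wcodeg_def t_def)
  qed
  have "weighted_family V (embeddings X A) (\<lambda>\<phi>. \<phi> ` X) (\<lambda>_. 1 / (real t * real M)) t \<gamma>"
  proof unfold_locales
    show "card (\<phi> ` X) = t" if "\<phi> \<in> embeddings X A" for \<phi>
      using that by (simp add: embeddings_def card_image t_def)
    show "\<phi> ` X \<subseteq> V" if "\<phi> \<in> embeddings X A" for \<phi>
      using that by (auto simp: embeddings_def)
    show "0 \<le> \<gamma>" by (rule order_trans[OF _ \<gamma>]) simp
  qed (use finV fin t deg codeg in auto)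
  then show ?thesis by (simp add: t_def)
qed

text \<open>The degrees sum to \<open>card (embeddings X A) / M\<close>. The deficiency therefore
  measures how far the number of embeddings falls short of \<open>card V * M\<close>, which
  \<open>card_embeddings_ge\<close> bounds.\<close>

lemma embeddings_total_deficiency:
  fixes D :: nat
  assumes tree: "htree k X A" and ne: "X \<noteq> {}"
    and D: "D \<ge> 1" and maxdeg: "\<And>v. v \<in> V \<Longrightarrow> edeg E v \<le> D"
  defines "M \<equiv> (fact (k - 1) * D) ^ card A"
  shows "(\<Sum>v\<in>V. 1 - wdeg (embeddings X A) (\<lambda>\<phi>. \<phi> ` X) (\<lambda>_. 1 / (real (card X) * real M)) v)
    \<le> real (card A) * ((\<Sum>v\<in>V. real D - real (edeg E v)) + real (card V) * real k * real (card X)) / real D"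
proof -
  interpret w: weighted_family V "embeddings X A" "\<lambda>\<phi>. \<phi> ` X" "\<lambda>_. 1 / (real (card X) * real M)"
    "card X" "real (card X) / real D"
    unfolding M_def by (rule embeddings_weighted_family[OF tree ne D maxdeg order_refl])
  have M: "real M > 0" using D by (simp add: M_def)
  have X: "real (card X) > 0" using w.t by simp
  have "(\<Sum>v\<in>V. 1 - wdeg (embeddings X A) (\<lambda>\<phi>. \<phi> ` X) (\<lambda>_. 1 / (real (card X) * real M)) v)
      = real (card V) - real (card (embeddings X A)) / real M"
    unfolding sum_subtractf w.total_weight using X by simp
  also have "\<dots> \<le> real (card A) * ((\<Sum>v\<in>V. real D - real (edeg E v)) + real (card V) * real k * real (card X)) / real D"
  proof -
    have "real M * (real (card V) * real D
          - real (card A) * ((\<Sum>v\<in>V. real D - real (edeg E v)) + real (card V) * real k * real (card X)))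
        \<le> real (card (embeddings X A)) * real D"
      unfolding M_def by (rule card_embeddings_ge[OF maxdeg tree])
    then have "real (card V) * real D
          - real (card A) * ((\<Sum>v\<in>V. real D - real (edeg E v)) + real (card V) * real k * real (card X))
        \<le> real (card (embeddings X A)) * real D / real M"
      using M by (simp add: pos_le_divide_eq mult.commute)
    then have "(real (card V) * real D
          - real (card A) * ((\<Sum>v\<in>V. real D - real (edeg E v)) + real (card V) * real k * real (card X))) / real D
        \<le> real (card (embeddings X A)) * real D / real M / real D"
      by (rule divide_right_mono) simp
    then show ?thesis using D by (simp add: diff_divide_distrib)
  qed
  finally show ?thesis .
qed

end

lemma embedding_is_copy:
  assumes lin: "linear_k_graph V F k" and tree: "htree k (verts T) (edges T)"
    and sub: "V \<subseteq> verts H" "F \<subseteq> edges H"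
    and \<phi>: "\<phi> \<in> linear_k_graph.embeddings V F (verts T) (edges T)"
  shows "is_copy T H (Hypergraph (\<phi> ` verts T) ((\<lambda>e. \<phi> ` e) ` edges T))"
proof -
  interpret linear_k_graph V F k by (rule lin)
  have "finite (verts T)" "\<And>e. e \<in> edges T \<Longrightarrow> e \<subseteq> verts T"
    using htree_finite[OF tree] htree_edges(2)[OF tree] by auto
  moreover have "\<phi> ` verts T \<subseteq> V" "inj_on \<phi> (verts T)" "\<And>e. e \<in> edges T \<Longrightarrow> \<phi> ` e \<in> F"
    using \<phi> by (auto simp: embeddings_def)
  ultimately show ?thesis
    using sub unfolding is_copy_def sub_hypergraph_def hypergraph_def isomorphic_def
    by (auto simp: bij_betw_def intro!: exI[of _ \<phi>])
qed

theorem theorem1p4: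
  fixes \<epsilon> :: real and k :: nat and T :: "'a hypergraph"
  assumes "\<epsilon> > 0" and "k \<ge> 2" and "linear_hypertree k T"
  shows "\<exists>C n\<^sub>0 :: real. C > 0 \<and> n\<^sub>0 > 0 \<and>
    (\<forall>n :: nat. real n \<ge> n\<^sub>0 \<longrightarrow>
      (\<forall>H :: 'b hypergraph.
        k_graph k H \<and> linear_hypergraph H \<and> card (verts H) = n \<and>
        real (min_degree H) \<ge> real n / real k + C \<longrightarrow>
        (\<exists>\<C>. (\<forall>G\<in>\<C>. is_copy T H G) \<and> vertex_disjoint \<C> \<and>
             real (card (\<Union>G\<in>\<C>. verts G)) \<ge> (1 - \<epsilon>) * real n)))"
proof -
  define X where "X = verts T"
  define A where "A = edges T"
  define t where "t = card X"
  define a where "a = real (card A)"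
  have tree: "htree k X A" unfolding X_def A_def by (rule linear_hypertree_htree[OF assms(3,2)])
  have ne: "X \<noteq> {}" using assms(3) by (simp add: linear_hypertree_def X_def)
  have t: "t \<ge> 1" using ne htree_finite[OF tree] by (simp add: t_def Suc_le_eq card_gt_0_iff)
  obtain \<eta> \<gamma> n\<^sub>1 where \<eta>: "\<eta> > 0" and \<gamma>: "\<gamma> > 0" and n\<^sub>1: "n\<^sub>1 > 0" and matching:
    "\<forall>(V :: 'b set) (I :: ('a \<Rightarrow> 'b) set) S w. weighted_family V I S w t \<gamma> \<longrightarrow> real (card V) \<ge> n\<^sub>1 \<longrightarrow>
       (\<Sum>v\<in>V. 1 - wdeg I S w v) \<le> \<eta> * real (card V) \<longrightarrow>
       (\<exists>M\<subseteq>I. disjoint_family_on S M \<and> real (card (\<Union>(S ` M))) \<ge> (1 - \<epsilon>) * real (card V))"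
    using almost_perfect_matching[OF assms(1) t] by blast
  \<comment> \<open>The degree deficit of \<open>F\<close> and the collision term each use half of
    \<open>\<eta>\<close>, after multiplication by the number \<open>a\<close> of edges of
    \<open>T\<close>. The \<open>+ 1\<close> covers a tree without edges.\<close>
  define \<eta>' where "\<eta>' = \<eta> / (2 * (a + 1))"
  have a: "a \<ge> 0" by (simp add: a_def)
  have \<eta>': "\<eta>' > 0" using \<eta> a by (simp add: \<eta>'_def)
  obtain \<delta> n\<^sub>2 where \<delta>: "\<delta> > 0" and n\<^sub>2: "n\<^sub>2 > 0" and regular:
    "\<forall>(V :: 'b set) E. linear_k_graph V E k \<longrightarrow> real (card V) \<ge> n\<^sub>2 \<longrightarrow>
    (\<forall>v\<in>V. real (card V) \<le> real k * real (edeg E v)) \<longrightarrow>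
    (\<exists>F\<subseteq>E. \<exists>D :: nat. real D \<ge> \<delta> * real (card V) \<and> (\<forall>v\<in>V. edeg F v \<le> D) \<and>
       (\<Sum>v\<in>V. real D - real (edeg F v)) \<le> \<eta>' * real D * real (card V))"
    using almost_regular_subgraph[OF \<eta>' assms(2)] by blast
  \<comment> \<open>Since \<open>D \<ge> \<delta> * n\<close>, this threshold brings the codegree
    bound \<open>t / D\<close> below \<open>\<gamma>\<close>, and the next one brings the collision
    term \<open>n * k * t\<close> below \<open>\<eta>' * D * n\<close>.\<close>
  define n\<^sub>3 where "n\<^sub>3 = real t / (\<gamma> * \<delta>)"
  define n\<^sub>4 where "n\<^sub>4 = real k * real t / (\<eta>' * \<delta>)"
  define n\<^sub>0 where "n\<^sub>0 = max (max n\<^sub>1 n\<^sub>2) (max n\<^sub>3 n\<^sub>4)"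
  have n\<^sub>0: "n\<^sub>1 \<le> n\<^sub>0" "n\<^sub>2 \<le> n\<^sub>0" "n\<^sub>3 \<le> n\<^sub>0" "n\<^sub>4 \<le> n\<^sub>0" by (auto simp: n\<^sub>0_def)
  have main: "\<exists>\<C>. (\<forall>G\<in>\<C>. is_copy T H G) \<and> vertex_disjoint \<C> \<and>
             real (card (\<Union>G\<in>\<C>. verts G)) \<ge> (1 - \<epsilon>) * real n"
    if n: "real n \<ge> n\<^sub>0" and H: "k_graph k H" "linear_hypergraph H" "card (verts H) = n"
      and mindeg: "real (min_degree H) \<ge> real n / real k + 1" for n and H :: "'b hypergraph"
  proof -
    define V where "V = verts H"
    interpret H: linear_k_graph V "edges H" k
      using H assms(2) by unfold_locales
        (auto simp: k_graph_def hypergraph_def linear_hypergraph_def V_def)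
    have cV: "real (card V) = real n" using H by (simp add: V_def)
    have n0: "real n > 0" using n n\<^sub>0 n\<^sub>1 by linarith
    have "real (card V) \<le> real k * real (edeg (edges H) v)" if v: "v \<in> V" for v
    proof -
      have "min_degree H \<le> edeg (edges H) v"
        unfolding min_degree_def using v H.finV
        by (intro Min_le) (auto simp: V_def edeg_def vertex_degree_def)
      then have "real n / real k \<le> real (edeg (edges H) v)" using mindeg by linarith
      then show ?thesis using assms(2) cV by (simp add: field_simps)
    qed
    then obtain F and D :: nat where F: "F \<subseteq> edges H" and D: "real D \<ge> \<delta> * real n"
      and maxdeg: "\<And>v. v \<in> V \<Longrightarrow> edeg F v \<le> D"
      and def: "(\<Sum>v\<in>V. real D - real (edeg F v)) \<le> \<eta>' * real D * real n"
      using regular H.linear_k_graph_axioms n n\<^sub>0(2) unfolding cV[symmetric]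
      by (meson order_trans)
    interpret F: linear_k_graph V F k by (rule H.subgraph[OF F])
    have n34: "n\<^sub>3 \<le> real n" "n\<^sub>4 \<le> real n" using n n\<^sub>0 by linarith+
    have dn: "\<delta> * real n > 0" using \<delta> n0 by simp
    have D0: "real D > 0" using D dn by linarith
    have D1: "D \<ge> 1" using D0 by simp
    have "real t \<le> \<gamma> * (\<delta> * real n)" using n34(1) \<gamma> \<delta> by (simp add: n\<^sub>3_def field_simps)
    also have "\<dots> \<le> \<gamma> * real D" using D \<gamma> by simp
    finally have t\<gamma>: "real (card X) / real D \<le> \<gamma>" using D0 by (simp add: t_def field_simps)
    have "real k * real t \<le> \<eta>' * (\<delta> * real n)" using n34(2) \<eta>' \<delta> by (simp add: n\<^sub>4_def field_simps)
    also have "\<dots> \<le> \<eta>' * real D" using D \<eta>' by simp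
    finally have kt: "real n * (real k * real t) \<le> real n * (\<eta>' * real D)" by (rule mult_left_mono) simp
    define M where "M = (fact (k - 1) * D) ^ card A"
    have fam: "weighted_family V (F.embeddings X A) (\<lambda>\<phi>. \<phi> ` X) (\<lambda>_. 1 / (real (card X) * real M)) t \<gamma>"
      unfolding M_def t_def by (rule F.embeddings_weighted_family[OF tree ne D1 maxdeg t\<gamma>])
    have "(\<Sum>v\<in>V. 1 - wdeg (F.embeddings X A) (\<lambda>\<phi>. \<phi> ` X) (\<lambda>_. 1 / (real (card X) * real M)) v)
        \<le> a * ((\<Sum>v\<in>V. real D - real (edeg F v)) + real n * real k * real t) / real D"
      unfolding M_def a_def t_def cV[symmetric]
      by (rule F.embeddings_total_deficiency[OF tree ne D1 maxdeg])
    also have "\<dots> \<le> a * (\<eta>' * real D * real n + \<eta>' * real D * real n) / real D"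
      using def kt a by (intro divide_right_mono mult_left_mono add_mono) (auto simp: mult_ac)
    also have "\<dots> = 2 * a * \<eta>' * real n" using D0 by (simp add: field_simps)
    also have "\<dots> \<le> 2 * (a + 1) * \<eta>' * real n"
      using \<eta>' n0 by (intro mult_right_mono) auto
    also have "\<dots> = \<eta> * real (card V)" using a by (simp add: \<eta>'_def cV)
    finally obtain M' where M': "M' \<subseteq> F.embeddings X A" "disjoint_family_on (\<lambda>\<phi>. \<phi> ` X) M'"
      "real (card (\<Union>((\<lambda>\<phi>. \<phi> ` X) ` M'))) \<ge> (1 - \<epsilon>) * real n"
      using matching fam n n\<^sub>0(1) unfolding cV[symmetric] by (meson order_trans)
    define copy where "copy \<phi> = Hypergraph (\<phi> ` X) ((\<lambda>e. \<phi> ` e) ` A)" for \<phi> :: "'a \<Rightarrow> 'b"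
    have "is_copy T H G" if "G \<in> copy ` M'" for G
      using that M'(1) embedding_is_copy[OF F.linear_k_graph_axioms, of T H] tree F
      unfolding copy_def X_def A_def V_def by blast
    \<comment> \<open>Distinct copies come from distinct embeddings in \<open>M'\<close>, and those
      have disjoint images.\<close>
    moreover have "vertex_disjoint (copy ` M')"
    proof -
      have "disjnt (verts (copy \<phi>)) (verts (copy \<psi>))"
        if "\<phi> \<in> M'" "\<psi> \<in> M'" "copy \<phi> \<noteq> copy \<psi>" for \<phi> \<psi>
      proof -
        have "\<phi> \<noteq> \<psi>" using that(3) by blast
        then show ?thesis
          using M'(2) that(1,2) unfolding disjoint_family_on_def copy_def disjnt_def by simp
      qed
      then show ?thesis unfolding vertex_disjoint_def pairwise_def by blast
    qed
    moreover have "(\<Union>G\<in>copy ` M'. verts G) = \<Union>((\<lambda>\<phi>. \<phi> ` X) ` M')" by (simp add: copy_def)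
    ultimately show ?thesis using M'(3) by (intro exI[of _ "copy ` M'"]) auto
  qed
  have "n\<^sub>0 > 0" using n\<^sub>0 n\<^sub>1 by linarith
  then show ?thesis using main by (intro exI[of _ 1] exI[of _ n\<^sub>0]) simp
qed

end
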